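(* Let $\lambda\in\mathbb Z$, and let $\mu=(\mu_1,\mu_2)$, $\mu_1\ge\mu_2\ge0$, range over partitions of length at most $2$. Put $\mathbf q^r=\{q^{1/2},q^{3/2},q^{5/2},\dots\}$ and $\mathbf q^n=\{q,q^2,q^3,\dots\}$. If $\lambda\ge0$, then $$\sum_{\mu:\ \mu_1-\mu_2\ge\lambda}HS_\mu(\mathbf q^r;\mathbf q^n)=q^{\frac{\lambda}{2}}\bigl(1+q^{\lambda+\frac12}\bigr)^{-1}\prod_{n\in\mathbb N,\ r\in\frac12+\mathbb Z_+}\frac{(1+q^r)^2}{(1-q^n)^2},$$ and if $\lambda<0$, then $$\sum_{\mu:\ \mu_2-\mu_1-1\le\lambda}HS_\mu(\mathbf q^r;\mathbf q^n)=q^{-\frac{\lambda+1}{2}}\bigl(1+q^{-\lambda-\frac12}\bigr)^{-1}\prod_{n\in\mathbb N,\ r\in\frac12+\mathbb Z_+}\frac{(1+q^r)^2}{(1-q^n)^2}.$$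
   Context: Here $\mathbb N=\{1,2,\dots\}$, $\mathbb Z_+=\{0,1,2,\dots\}$, and the identities are between formal power series in $q^{1/2}$. The product $\prod_{n\in\mathbb N,r\in\frac12+\mathbb Z_+}\frac{(1+q^r)^2}{(1-q^n)^2}$ means $\prod_{r\in\frac12+\mathbb Z_+}(1+q^r)^2\big/\prod_{n\in\mathbb N}(1-q^n)^2$. For a partition $\lambda$ the hook Schur function is $HS_\lambda(\mathbf x;\mathbf y)=\sum_{\mu\subset\lambda}s_\mu(\mathbf x)s_{\lambda'/\mu'}(\mathbf y)$, where $s$ denotes (skew) Schur functions in the countable variable sets $\mathbf x$, $\mathbf y$, and $'$ denotes the conjugate partition. *)

theory Defs
  imports "HOL-Analysis.Analysis"
begin

text \<open>
  A partition is a weakly decreasing sequence of naturals with finite support; the parts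
  \<open>\<mu>\<^sub>1, \<mu>\<^sub>2, \<dots>\<close> are \<open>mu 0, mu 1, \<dots>\<close>. Containment of partitions is the pointwise order
  on functions, and the empty partition is \<open>\<lambda>_. 0\<close>.
\<close>

definition is_partition :: "(nat \<Rightarrow> nat) \<Rightarrow> bool" where
  "is_partition mu \<longleftrightarrow> antimono mu \<and> finite {i. mu i \<noteq> 0}"

definition partition_length :: "(nat \<Rightarrow> nat) \<Rightarrow> nat" where
  "partition_length mu = card {i. mu i \<noteq> 0}"

definition conjugate :: "(nat \<Rightarrow> nat) \<Rightarrow> (nat \<Rightarrow> nat)" where
  "conjugate mu = (\<lambda>j. card {i. j < mu i})"

definition skew_diagram :: "(nat \<Rightarrow> nat) \<Rightarrow> (nat \<Rightarrow> nat) \<Rightarrow> (nat \<times> nat) set" where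
  "skew_diagram la mu = {(i, j). mu i \<le> j \<and> j < la i}"

text \<open>
  Semistandard tableaux of shape \<open>la/mu\<close>, with entries in \<open>nat\<close>. They are taken extensional,
  so that each filling of the diagram is represented by exactly one function.
\<close>

definition ssyt :: "(nat \<Rightarrow> nat) \<Rightarrow> (nat \<Rightarrow> nat) \<Rightarrow> (nat \<times> nat \<Rightarrow> nat) set" where
  "ssyt la mu = {T \<in> extensional (skew_diagram la mu).
     (\<forall>i j. (i, j) \<in> skew_diagram la mu \<and> (i, Suc j) \<in> skew_diagram la mu
        \<longrightarrow> T (i, j) \<le> T (i, Suc j)) \<and>
     (\<forall>i j. (i, j) \<in> skew_diagram la mu \<and> (Suc i, j) \<in> skew_diagram la mu
        \<longrightarrow> T (i, j) < T (Suc i, j))}"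

text \<open>
  (Skew) Schur functions evaluated at the countable family \<open>x 0, x 1, \<dots>\<close>; the sum over tableaux
  is infinite and is taken in the topology of the ring. For formal power series this is the
  \<open>X\<close>-adic topology.
\<close>

definition skew_schur ::
    "(nat \<Rightarrow> nat) \<Rightarrow> (nat \<Rightarrow> nat) \<Rightarrow> (nat \<Rightarrow> 'a) \<Rightarrow> 'a::{comm_semiring_1, t2_space}" where
  "skew_schur la mu x =
     (if mu \<le> la then \<Sum>\<^sub>\<infinity>T\<in>ssyt la mu. \<Prod>c\<in>skew_diagram la mu. x (T c) else 0)"

definition schur :: "(nat \<Rightarrow> nat) \<Rightarrow> (nat \<Rightarrow> 'a) \<Rightarrow> 'a::{comm_semiring_1, t2_space}" where
  "schur la x = skew_schur la (\<lambda>_. 0) x"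

definition hook_schur ::
    "(nat \<Rightarrow> nat) \<Rightarrow> (nat \<Rightarrow> 'a) \<Rightarrow> (nat \<Rightarrow> 'a) \<Rightarrow> 'a::{comm_semiring_1, t2_space}" where
  "hook_schur la x y =
     (\<Sum>mu | is_partition mu \<and> mu \<le> la.
        schur mu x * skew_schur (conjugate la) (conjugate mu) y)"

text \<open>
  Power series in \<open>q\<^sup>1\<^sup>/\<^sup>2\<close> are elements of \<open>'a fps\<close> with \<open>fps_X\<close> playing the role of \<open>q\<^sup>1\<^sup>/\<^sup>2\<close>,
  so that \<open>q\<^sup>m\<^sup>/\<^sup>2\<close> is \<open>fps_X ^ m\<close>. The families below are \<open>(q\<^sup>1\<^sup>/\<^sup>2, q\<^sup>3\<^sup>/\<^sup>2, \<dots>)\<close> and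
  \<open>(q, q\<^sup>2, \<dots>)\<close>.
\<close>

definition q_r :: "nat \<Rightarrow> 'a::field_char_0 fps" where
  "q_r k = fps_X ^ (2 * k + 1)"

definition q_n :: "nat \<Rightarrow> 'a::field_char_0 fps" where
  "q_n k = fps_X ^ (2 * (k + 1))"

definition q_product :: "'a::field_char_0 fps" where
  "q_product = (\<Prod>k. (1 + q_r k)\<^sup>2) / (\<Prod>k. (1 - q_n k)\<^sup>2)"

end

theory Submission
  imports Defs
begin

text \<open>
  A hook Schur function of a two-row shape counts pairs of rows over a mixed alphabet in which
  no column is violated. Exchanging tails at the first violation matches the bad pairs whose lengths
  differ by at least \<open>d\<close> with all pairs whose lengths differ by at least \<open>d + 2\<close>, so the sum over
  all shapes with \<open>\<mu>\<^sub>1 - \<mu>\<^sub>2 \<ge> d\<close> equals \<open>c\<^sub>d + c\<^sub>d\<^sub>+\<^sub>1\<close>, where \<open>c\<^sub>d\<close> counts pairs with length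
  difference exactly \<open>d\<close>. Removing the smallest letters of either row yields the recurrence
  \<open>(1 + q\<^sup>d\<^sup>+\<^sup>3\<^sup>/\<^sup>2) (c\<^sub>d\<^sub>+\<^sub>1 + c\<^sub>d\<^sub>+\<^sub>2) = q\<^sup>1\<^sup>/\<^sup>2 (1 + q\<^sup>d\<^sup>+\<^sup>1\<^sup>/\<^sup>2) (c\<^sub>d + c\<^sub>d\<^sub>+\<^sub>1)\<close>, which gives the
  dependence on \<open>d\<close>. The constant is found by letting \<open>d\<close> tend to infinity: rows of length \<open>n\<close>
  have generating function \<open>q\<^sup>n\<^sup>/\<^sup>2 g\<^sub>n\<close>, where \<open>g\<^sub>n\<close> converges to the square root \<open>R\<close> of the
  product, and \<open>(1 + q\<^sup>1\<^sup>/\<^sup>2) \<Sum>\<^sub>b q\<^sup>b g\<^sub>b = R\<close> telescopes.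
\<close>

section \<open>Weight generating functions\<close>

definition finite_fibres :: "('s \<Rightarrow> nat) \<Rightarrow> 's set \<Rightarrow> bool" where
  "finite_fibres w S \<longleftrightarrow> (\<forall>n. finite {s \<in> S. w s = n})"

text \<open>An infinite fibre is counted as \<open>0\<close> here, so most facts need \<^const>\<open>finite_fibres\<close>.\<close>

definition weight_gf :: "('s \<Rightarrow> nat) \<Rightarrow> 's set \<Rightarrow> 'a::field_char_0 fps" where
  "weight_gf w S = Abs_fps (\<lambda>n. of_nat (card {s \<in> S. w s = n}))"

lemma weight_gf_nth [simp]: "fps_nth (weight_gf w S) n = of_nat (card {s \<in> S. w s = n})"
  by (simp add: weight_gf_def)

lemma finite_fibres_subset: "finite_fibres w T \<Longrightarrow> S \<subseteq> T \<Longrightarrow> finite_fibres w S"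
  unfolding finite_fibres_def
proof
  fix n
  assume "\<forall>n. finite {s \<in> T. w s = n}" "S \<subseteq> T"
  then show "finite {s \<in> S. w s = n}"
    by (auto intro: finite_subset[of _ "{s \<in> T. w s = n}"])
qed

lemma finite_fibres_times:
  assumes "finite_fibres w S" "finite_fibres v T"
  shows "finite_fibres (\<lambda>(s, t). w s + v t) (S \<times> T)"
  unfolding finite_fibres_def
proof
  fix n
  have "{p \<in> S \<times> T. (case p of (s, t) \<Rightarrow> w s + v t) = n}
      \<subseteq> (\<Union>i\<le>n. {s \<in> S. w s = i} \<times> {t \<in> T. v t = n - i})"
    by auto
  moreover have "finite (\<Union>i\<le>n. {s \<in> S. w s = i} \<times> {t \<in> T. v t = n - i})"
    using assms by (auto simp: finite_fibres_def)
  ultimately show "finite {p \<in> S \<times> T. (case p of (s, t) \<Rightarrow> w s + v t) = n}"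
    by (rule finite_subset)
qed

lemma weight_gf_inj_image:
  assumes "inj_on f S" "\<And>s. s \<in> S \<Longrightarrow> w (f s) = v s + c"
  shows "weight_gf w (f ` S) = (fps_X ^ c * weight_gf v S :: 'a::field_char_0 fps)"
proof (rule fps_ext)
  fix n
  have "{t \<in> f ` S. w t = n} = f ` {s \<in> S. v s + c = n}"
    using assms(2) by auto
  moreover have "inj_on f {s \<in> S. v s + c = n}"
    using assms(1) by (rule inj_on_subset) auto
  ultimately have "card {t \<in> f ` S. w t = n} = card {s \<in> S. v s + c = n}"
    by (simp add: card_image)
  also have "{s \<in> S. v s + c = n} = (if n < c then {} else {s \<in> S. v s = n - c})"
    by auto
  finally show "fps_nth (weight_gf w (f ` S) :: 'a fps) n = fps_nth (fps_X ^ c * weight_gf v S) n"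
    by (simp add: fps_X_power_mult_nth)
qed

lemma weight_gf_bij_betw:
  assumes "bij_betw f S T" "\<And>s. s \<in> S \<Longrightarrow> w (f s) = v s"
  shows "weight_gf w T = weight_gf v S"
  using weight_gf_inj_image[of f S w v 0] assms by (simp add: bij_betw_def)

lemma weight_gf_Un:
  assumes "finite_fibres w S" "finite_fibres w T" "S \<inter> T = {}"
  shows "weight_gf w (S \<union> T) = (weight_gf w S + weight_gf w T :: 'a::field_char_0 fps)"
proof (rule fps_ext)
  fix n
  have "{s \<in> S \<union> T. w s = n} = {s \<in> S. w s = n} \<union> {s \<in> T. w s = n}"
    by auto
  then show "fps_nth (weight_gf w (S \<union> T) :: 'a fps) n = fps_nth (weight_gf w S + weight_gf w T) n"
    using assms by (auto simp: card_Un_disjoint finite_fibres_def disjoint_iff)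
qed

lemma weight_gf_times:
  assumes "finite_fibres w S" "finite_fibres v T"
  shows "weight_gf (\<lambda>(s, t). w s + v t) (S \<times> T)
    = (weight_gf w S * weight_gf v T :: 'a::field_char_0 fps)"
proof (rule fps_ext)
  fix n
  have eq: "{p \<in> S \<times> T. (case p of (s, t) \<Rightarrow> w s + v t) = n}
      = (\<Union>i\<in>{0..n}. {s \<in> S. w s = i} \<times> {t \<in> T. v t = n - i})"
    by auto
  have "card {p \<in> S \<times> T. (case p of (s, t) \<Rightarrow> w s + v t) = n}
      = (\<Sum>i=0..n. card ({s \<in> S. w s = i} \<times> {t \<in> T. v t = n - i}))"
    unfolding eq using assms by (subst card_UN_disjoint) (auto simp: finite_fibres_def)
  then show "fps_nth (weight_gf (\<lambda>(s, t). w s + v t) (S \<times> T) :: 'a fps) n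
      = fps_nth (weight_gf w S * weight_gf v T) n"
    by (simp add: fps_mult_nth card_cartesian_product)
qed

text \<open>X-adic convergence is coefficientwise, and in degree \<open>n\<close> only the values of
  \<open>f\<close> on the finitely many elements of weight \<open>n\<close> contribute.\<close>

lemma has_sum_weight_gf_fibres:
  assumes "finite_fibres w U" "f ` U \<subseteq> I"
  shows "((\<lambda>i. weight_gf w {u \<in> U. f u = i}) has_sum (weight_gf w U :: 'a::field_char_0 fps)) I"
proof (rule has_sum_fpsI)
  fix n
  let ?V = "{u \<in> U. w u = n}"
  have fin: "finite ?V"
    using assms(1) by (simp add: finite_fibres_def)
  have fin': "finite {u \<in> ?V. f u = i}" for i
    by (rule finite_subset[OF _ fin]) auto
  have fibre: "{u \<in> {u \<in> U. f u = i}. w u = n} = {u \<in> ?V. f u = i}" for i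
    by auto
  \<comment> \<open>In characteristic 0 a nonzero cardinality stays nonzero under
    \<open>of_nat\<close>, so the support is exactly the image under \<open>f\<close> of the
    elements of weight \<open>n\<close>.\<close>
  have supp: "{i \<in> I. fps_nth (weight_gf w {u \<in> U. f u = i}) n \<noteq> (0::'a)} = f ` ?V"
  proof (intro equalityI subsetI)
    fix i assume "i \<in> {i \<in> I. fps_nth (weight_gf w {u \<in> U. f u = i}) n \<noteq> (0::'a)}"
    then have "card {u \<in> ?V. f u = i} \<noteq> 0"
      unfolding weight_gf_nth fibre by auto
    then have "{u \<in> ?V. f u = i} \<noteq> {}"
      by (rule contrapos_nn) (simp only: card.empty)
    then show "i \<in> f ` ?V"
      by blast
  next
    fix i assume "i \<in> f ` ?V"
    then have "{u \<in> ?V. f u = i} \<noteq> {}" "i \<in> I"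
      using assms(2) by auto
    then have "card {u \<in> ?V. f u = i} \<noteq> 0" "i \<in> I"
      using fin' by (simp_all only: card_0_eq not_False_eq_True)
    moreover from this(1) have "fps_nth (weight_gf w {u \<in> U. f u = i}) n \<noteq> (0::'a)"
      unfolding weight_gf_nth fibre by simp
    ultimately show "i \<in> {i \<in> I. fps_nth (weight_gf w {u \<in> U. f u = i}) n \<noteq> (0::'a)}"
      by blast
  qed
  show "finite {i \<in> I. fps_nth (weight_gf w {u \<in> U. f u = i}) n \<noteq> (0::'a)}"
    unfolding supp using fin by simp
  have "card ?V = (\<Sum>i\<in>f ` ?V. card {u \<in> ?V. f u = i})"
    using fin fin' by (subst card_UN_disjoint[symmetric]) (auto intro!: arg_cong[where f = card])
  then show "fps_nth (weight_gf w U) n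
      = (\<Sum>i | i \<in> I \<and> fps_nth (weight_gf w {u \<in> U. f u = i}) n \<noteq> (0::'a).
          fps_nth (weight_gf w {u \<in> U. f u = i}) n)"
    unfolding supp unfolding weight_gf_nth fibre by simp
qed

lemma sum_weight_gf_fibres:
  assumes "finite_fibres w U" "f ` U \<subseteq> I" "finite I"
  shows "(\<Sum>i\<in>I. weight_gf w {u \<in> U. f u = i}) = weight_gf w U"
  using infsumI[OF has_sum_weight_gf_fibres[OF assms(1,2)]] assms(3) by simp

text \<open>The fibres of \<open>id\<close> are singletons, each with generating function
  \<open>fps_X ^ w s\<close>. This turns the infinite sums over tableaux into counting.\<close>

lemma infsum_fps_X_power:
  assumes "finite_fibres w S"
  shows "(\<Sum>\<^sub>\<infinity>s\<in>S. fps_X ^ w s) = (weight_gf w S :: 'a::field_char_0 fps)"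
proof -
  have "weight_gf w {u \<in> S. id u = s} = (fps_X ^ w s :: 'a fps)" if "s \<in> S" for s
  proof (rule fps_ext)
    fix n
    have "{u \<in> {u \<in> S. id u = s}. w u = n} = (if n = w s then {s} else {})"
      using that by auto
    then show "fps_nth (weight_gf w {u \<in> S. id u = s} :: 'a fps) n = fps_nth (fps_X ^ w s) n"
      by simp
  qed
  then have "(\<Sum>\<^sub>\<infinity>s\<in>S. fps_X ^ w s :: 'a fps) = (\<Sum>\<^sub>\<infinity>s\<in>S. weight_gf w {u \<in> S. id u = s})"
    by (intro infsum_cong) simp
  also have "\<dots> = weight_gf w S"
    by (rule infsumI[OF has_sum_weight_gf_fibres]) (use assms in auto)
  finally show ?thesis .
qed

section \<open>Rows of hook tableaux\<close>

text \<open>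
  \<open>Inl k\<close> stands for the variable \<open>q\<^sup>k\<^sup>+\<^sup>1\<^sup>/\<^sup>2\<close> of the first alphabet and \<open>Inr k\<close> for the variable
  \<open>q\<^sup>k\<^sup>+\<^sup>1\<close> of the second. The relation says which letters may be neighbours in a row of a hook
  tableau; the letter \<open>b\<close> may stand directly below \<open>a\<close> iff \<open>\<not> row_le b a\<close>.
\<close>

fun row_le :: "nat + nat \<Rightarrow> nat + nat \<Rightarrow> bool" where
  "row_le (Inl a) (Inl b) \<longleftrightarrow> a \<le> b"
| "row_le (Inl a) (Inr b) \<longleftrightarrow> True"
| "row_le (Inr a) (Inl b) \<longleftrightarrow> False"
| "row_le (Inr a) (Inr b) \<longleftrightarrow> a < b"

lemma transp_row_le: "transp row_le"
proof
  fix a b c assume "row_le a b" "row_le b c"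
  then show "row_le a c" by (cases a; cases b; cases c) auto
qed

text \<open>A column step from \<open>a\<close> down to \<open>b\<close> and a row step from
  \<open>b\<close> to \<open>c\<close> combine to a row step from \<open>a\<close> to
  \<open>c\<close>. This lets the head of one row be joined to the tail of the row below it.\<close>

lemma not_row_le_trans: "\<not> row_le b a \<Longrightarrow> row_le b c \<Longrightarrow> row_le a c"
  by (cases a; cases b; cases c) auto

fun letter_weight :: "nat + nat \<Rightarrow> nat" where
  "letter_weight (Inl k) = 2 * k + 1"
| "letter_weight (Inr k) = 2 * (k + 1)"

definition word_weight :: "(nat + nat) list \<Rightarrow> nat" where
  "word_weight A = sum_list (map letter_weight A)"

lemma word_weight_simps [simp]:
  "word_weight [] = 0"
  "word_weight (a # A) = letter_weight a + word_weight A"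
  "word_weight (A @ B) = word_weight A + word_weight B"
  by (simp_all add: word_weight_def)

definition row_words :: "(nat + nat) list set" where
  "row_words = {A. sorted_wrt row_le A}"

lemma length_le_word_weight: "length A \<le> word_weight A"
proof (induction A)
  case (Cons a A)
  then show ?case by (cases a) auto
qed simp

lemma finite_fibres_word_weight: "finite_fibres word_weight A"
proof -
  have bound: "a \<in> Inl ` {..n} \<union> Inr ` {..n}" if "letter_weight a \<le> n" for a n
    using that by (cases a) auto
  have letter: "letter_weight a \<le> word_weight A" if "a \<in> set A" for a A
    using that by (induction A) auto
  have "finite {A \<in> UNIV. word_weight A = n}" for n
  proof (rule finite_subset)
    show "{A \<in> UNIV. word_weight A = n}
        \<subseteq> {A. set A \<subseteq> Inl ` {..n} \<union> Inr ` {..n} \<and> length A \<le> n}"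
      using bound letter length_le_word_weight by blast
    show "finite {A :: (nat + nat) list. set A \<subseteq> Inl ` {..n} \<union> Inr ` {..n} \<and> length A \<le> n}"
      by (rule finite_lists_length_le) auto
  qed
  then show ?thesis
    by (auto simp: finite_fibres_def)
qed

section \<open>Decomposition of rows by the smallest letters\<close>

text \<open>Multiplication of all variables by q, which adds 2 to each weight since
  \<open>fps_X\<close> is the square root of q. Only the smallest letter of each alphabet lies
  outside the range.\<close>

definition up :: "nat + nat \<Rightarrow> nat + nat" where
  "up = map_sum Suc Suc"

lemma up_simps [simp]: "up (Inl k) = Inl (Suc k)" "up (Inr k) = Inr (Suc k)"
  by (simp_all add: up_def)

lemma up_neq [simp]: "up a \<noteq> Inl 0" "up a \<noteq> Inr 0" "Inl 0 \<noteq> up a" "Inr 0 \<noteq> up a"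
  by (cases a; simp)+

lemma inj_up: "inj up"
  by (simp add: up_def sum.inj_map)

lemma range_up: "range up = - {Inl 0, Inr 0}"
proof (intro equalityI subsetI)
  fix x :: "nat + nat" assume "x \<in> - {Inl 0, Inr 0}"
  then have "x = up (map_sum (\<lambda>k. k - 1) (\<lambda>k. k - 1) x)"
    by (cases x) auto
  then show "x \<in> range up" by blast
qed (auto simp: up_def map_sum_def split: sum.splits)

lemma row_le_up [simp]: "row_le (up a) (up b) = row_le a b"
  by (cases a; cases b) auto

lemma map_up_row_words [simp]: "map up A \<in> row_words \<longleftrightarrow> A \<in> row_words"
  by (simp add: row_words_def sorted_wrt_map)

lemma letter_weight_up [simp]: "letter_weight (up a) = letter_weight a + 2"
  by (cases a) auto

lemma word_weight_map_up [simp]: "word_weight (map up A) = word_weight A + 2 * length A"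
  by (induction A) auto

text \<open>The operation behind the term \<open>q z H(q z)\<close> in the functional equation of
  the rows: every letter is shifted, then one \<open>Inr 0\<close> is placed between the alphabets,
  the only position that \<open>row_le\<close> allows it.\<close>

definition insert_fermion :: "(nat + nat) list \<Rightarrow> (nat + nat) list" where
  "insert_fermion A = map up (filter isl A) @ Inr 0 # map up (filter (\<lambda>a. \<not> isl a) A)"

lemma row_words_split: "A \<in> row_words \<Longrightarrow> filter isl A @ filter (\<lambda>a. \<not> isl a) A = A"
proof (induction A)
  case (Cons a A)
  show ?case
  proof (cases a)
    case (Inl k)
    then show ?thesis using Cons by (simp add: row_words_def)
  next
    case (Inr k)
    then have "\<forall>b\<in>set A. \<not> isl b"
      using Cons.prems by (auto simp: row_words_def isl_def)
    then show ?thesis using Inr by (simp add: filter_empty_conv)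
  qed
qed simp

lemma word_weight_insert_fermion:
  "word_weight (insert_fermion A) = word_weight A + 2 * length A + 2"
proof -
  have "word_weight (filter isl A) + word_weight (filter (\<lambda>a. \<not> isl a) A) = word_weight A"
    by (induction A) auto
  then show ?thesis
    using sum_length_filter_compl[of isl A] by (simp add: insert_fermion_def)
qed

lemma length_insert_fermion [simp]: "length (insert_fermion A) = Suc (length A)"
  using sum_length_filter_compl[of isl A] by (simp add: insert_fermion_def)

lemma insert_fermion_row_words: "A \<in> row_words \<Longrightarrow> insert_fermion A \<in> row_words"
proof -
  assume "A \<in> row_words"
  then have "sorted_wrt row_le (filter isl A)" "sorted_wrt row_le (filter (\<lambda>a. \<not> isl a) A)"
    by (auto simp: row_words_def sorted_wrt_filter)
  moreover have "row_le (up a) (Inr 0)" if "isl a" for a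
    using that by (cases a) auto
  moreover have "row_le (Inr 0) (up a)" if "\<not> isl a" for a
    using that by (cases a) auto
  moreover have "row_le a b" if "isl a" "\<not> isl b" for a b
    using that by (cases a; cases b) auto
  ultimately show ?thesis
    by (simp add: insert_fermion_def row_words_def sorted_wrt_append sorted_wrt_map)
qed

text \<open>Deleting the inserted letter recovers the shifted row, which makes
  \<open>insert_fermion\<close> injective on rows.\<close>

lemma filter_insert_fermion:
  "A \<in> row_words \<Longrightarrow> filter (\<lambda>a. a \<noteq> Inr 0) (insert_fermion A) = map up A"
proof -
  assume A: "A \<in> row_words"
  have [simp]: "filter (\<lambda>a. a \<noteq> Inr 0) (map up B) = map up B" for B
    using range_up by (auto simp: filter_id_conv)
  show ?thesis
    using row_words_split[OF A] by (simp add: insert_fermion_def flip: map_append)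
qed

lemma row_words_Cons_Inl_0 [simp]: "Inl 0 # A \<in> row_words \<longleftrightarrow> A \<in> row_words"
proof -
  have "row_le (Inl 0) a" for a by (cases a) auto
  then show ?thesis by (simp add: row_words_def)
qed

lemma inj_on_insert_fermion: "inj_on insert_fermion row_words"
proof (rule inj_onI)
  fix A B assume "A \<in> row_words" "B \<in> row_words" "insert_fermion A = insert_fermion B"
  then have "map up A = map up B"
    using filter_insert_fermion by metis
  then show "A = B"
    using inj_up by (simp add: inj_map_eq_map)
qed

text \<open>
  This decomposition is the functional equation
  \<open>(1 - q\<^sup>1\<^sup>/\<^sup>2 z) H(z) = (1 + q z) H(q z)\<close> for the generating function \<open>H\<close> of the rows.
\<close>

lemma row_words_decomp:
  "row_words = (#) (Inl 0) ` row_words \<union> map up ` row_words \<union> insert_fermion ` row_words" (is "_ = ?R")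
proof (intro equalityI subsetI)
  fix A assume A: "A \<in> row_words"
  show "A \<in> ?R"
  proof (cases "Inl 0 \<in> set A")
    case True
    then obtain P Q where PQ: "A = P @ Inl 0 # Q"
      by (meson split_list)
    \<comment> \<open>Nothing but \<open>Inl 0\<close> may precede \<open>Inl 0\<close>, so the row
      begins with it.\<close>
    have "p = Inl 0" if "p \<in> set P" for p
    proof -
      have "row_le p (Inl 0)" using A that by (auto simp: PQ row_words_def sorted_wrt_append)
      then show ?thesis by (cases p) auto
    qed
    then obtain B where "A = Inl 0 # B"
      using PQ by (cases P) auto
    then show ?thesis using A by auto
  next
    case no_x: False
    show ?thesis
    proof (cases "Inr 0 \<in> set A")
      case True
      then obtain P Q where PQ: "A = P @ Inr 0 # Q"
        by (meson split_list)
      have P: "isl p" if "p \<in> set P" for p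
      proof -
        have "row_le p (Inr 0)" using A that by (auto simp: PQ row_words_def sorted_wrt_append)
        then show ?thesis by (cases p) auto
      qed
      have Q: "\<not> isl p \<and> p \<noteq> Inr 0" if "p \<in> set Q" for p
      proof -
        have "row_le (Inr 0) p" using A that by (auto simp: PQ row_words_def sorted_wrt_append)
        then show ?thesis by (cases p) auto
      qed
      \<comment> \<open>\<open>P\<close> lies in the first alphabet, \<open>Q\<close> in the second
        with \<open>Inr 0\<close> excluded by strictness, and \<open>Inl 0\<close> is absent in this
        case: every letter besides the one \<open>Inr 0\<close> is a shift.\<close>
      have "set P \<subseteq> range up" "set Q \<subseteq> range up"
        using P[of "Inr 0"] Q no_x by (auto simp: range_up PQ)
      then have "\<exists>P'. P = map up P'" "\<exists>Q'. Q = map up Q'"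
        unfolding ex_map_conv by auto
      then obtain P' Q' where P'Q': "P = map up P'" "Q = map up Q'"
        by blast
      have isl_up: "isl (up a) = isl a" for a by (cases a) auto
      have "filter isl P' = P'" "filter (\<lambda>a. \<not> isl a) P' = []"
        "filter isl Q' = []" "filter (\<lambda>a. \<not> isl a) Q' = Q'"
        using P Q isl_up by (auto simp: P'Q' filter_id_conv filter_empty_conv)
      then have "A = insert_fermion (P' @ Q')"
        by (simp add: PQ P'Q' insert_fermion_def)
      moreover have "P' @ Q' \<in> row_words"
        using A by (auto simp: PQ P'Q' row_words_def sorted_wrt_append sorted_wrt_map)
      ultimately show ?thesis by blast
    next
      case False
      then have "set A \<subseteq> range up"
        using no_x by (auto simp: range_up)
      then have "\<exists>A'. A = map up A'"
        unfolding ex_map_conv by auto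
      then obtain A' where "A = map up A'"
        by blast
      then show ?thesis using A by auto
    qed
  qed
qed (auto simp: insert_fermion_row_words)

text \<open>The pieces are told apart by the smallest letters: the first contains
  \<open>Inl 0\<close>, the second neither \<open>Inl 0\<close> nor \<open>Inr 0\<close>, the third
  \<open>Inr 0\<close> but not \<open>Inl 0\<close>.\<close>

lemma row_words_decomp_disjoint:
  "(#) (Inl 0) ` row_words \<inter> map up ` row_words = {}"
  "((#) (Inl 0) ` row_words \<union> map up ` row_words) \<inter> insert_fermion ` row_words = {}"
proof -
  have cons: "Inl 0 \<in> set x" if "x \<in> (#) (Inl 0) ` row_words" for x
    using that by auto
  have up: "Inl 0 \<notin> set x \<and> Inr 0 \<notin> set x" if "x \<in> map up ` row_words" for x
    using that by auto
  have ins: "Inl 0 \<notin> set x \<and> Inr 0 \<in> set x" if "x \<in> insert_fermion ` row_words" for x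
    using that by (auto simp: insert_fermion_def)
  show "(#) (Inl 0) ` row_words \<inter> map up ` row_words = {}"
  proof (rule equals0I)
    fix x assume "x \<in> (#) (Inl 0) ` row_words \<inter> map up ` row_words"
    then show False using cons[of x] up[of x] by simp
  qed
  show "((#) (Inl 0) ` row_words \<union> map up ` row_words) \<inter> insert_fermion ` row_words = {}"
  proof (rule equals0I)
    fix x assume "x \<in> ((#) (Inl 0) ` row_words \<union> map up ` row_words) \<inter> insert_fermion ` row_words"
    then have "x \<in> (#) (Inl 0) ` row_words \<or> x \<in> map up ` row_words" "x \<in> insert_fermion ` row_words"
      by simp_all
    then show False using cons[of x] up[of x] ins[of x] by argo
  qed
qed

section \<open>Two-row tableaux by exchange of tails\<close>

definition pair_weight :: "(nat + nat) list \<times> (nat + nat) list \<Rightarrow> nat" where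
  "pair_weight = (\<lambda>(A, B). word_weight A + word_weight B)"

definition row_pairs :: "nat \<Rightarrow> ((nat + nat) list \<times> (nat + nat) list) set" where
  "row_pairs d = {(A, B). A \<in> row_words \<and> B \<in> row_words \<and> length A = length B + d}"

definition wide_pairs :: "nat \<Rightarrow> ((nat + nat) list \<times> (nat + nat) list) set" where
  "wide_pairs d = {(A, B). A \<in> row_words \<and> B \<in> row_words \<and> length B + d \<le> length A}"

definition crosses :: "(nat + nat) list \<Rightarrow> (nat + nat) list \<Rightarrow> nat \<Rightarrow> bool" where
  "crosses A B j \<longleftrightarrow> j < length B \<and> row_le (B ! j) (A ! j)"

text \<open>The mark that an exchange of tails leaves behind. It always occurs, at the latest at
  \<open>length B\<close>, so every pair has a first one from which the exchange can be
  undone.\<close>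

definition recrosses :: "(nat + nat) list \<Rightarrow> (nat + nat) list \<Rightarrow> nat \<Rightarrow> bool" where
  "recrosses A B j \<longleftrightarrow> length B \<le> j \<or> row_le (A ! j) (B ! j)"

definition tableaux :: "nat \<Rightarrow> ((nat + nat) list \<times> (nat + nat) list) set" where
  "tableaux d = {(A, B) \<in> wide_pairs d. \<forall>j. \<not> crosses A B j}"

text \<open>
  The sign-reversing involution behind the Jacobi-Trudi identity for two rows: at the first
  column violation the tails of the rows are exchanged, with a shift by one cell.
\<close>

definition swap_tails :: "nat \<Rightarrow> 'b list \<times> 'b list \<Rightarrow> 'b list \<times> 'b list" where
  "swap_tails j = (\<lambda>(A, B). (take (Suc j) B @ drop j A, take j A @ drop (Suc j) B))"

definition unswap_tails :: "nat \<Rightarrow> 'b list \<times> 'b list \<Rightarrow> 'b list \<times> 'b list" where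
  "unswap_tails j = (\<lambda>(A, B). (take j B @ drop (Suc j) A, take (Suc j) A @ drop j B))"

lemma row_words_nth: "A \<in> row_words \<Longrightarrow> i < j \<Longrightarrow> j < length A \<Longrightarrow> row_le (A ! i) (A ! j)"
  by (simp add: row_words_def sorted_wrt_iff_nth_less)

lemma row_le_trans: "row_le a b \<Longrightarrow> row_le b c \<Longrightarrow> row_le a c"
  using transp_row_le by (rule transpD)

lemma row_words_splice:
  assumes "A \<in> row_words" "B \<in> row_words"
    and le: "\<And>i k. i < m \<Longrightarrow> i < length A \<Longrightarrow> n \<le> k \<Longrightarrow> k < length B \<Longrightarrow> row_le (A ! i) (B ! k)"
  shows "take m A @ drop n B \<in> row_words"
proof -
  have "row_le x y" if x: "x \<in> set (take m A)" and y: "y \<in> set (drop n B)" for x y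
  proof -
    obtain i where "i < m" "i < length A" "x = A ! i"
      using x by (auto simp: in_set_conv_nth)
    moreover obtain k where "k < length B - n" "y = B ! (n + k)"
      using y by (auto simp: in_set_conv_nth)
    ultimately show ?thesis
      using le[of i "n + k"] by simp
  qed
  then show ?thesis
    using assms(1,2) by (simp add: row_words_def sorted_wrt_append sorted_wrt_take sorted_wrt_drop)
qed

lemma row_words_splice_le:
  assumes "A \<in> row_words" "B \<in> row_words" "j < length A" "j' < length B" "row_le (A ! j) (B ! j')"
  shows "take (Suc j) A @ drop j' B \<in> row_words"
proof (rule row_words_splice[OF assms(1,2)])
  fix i k assume *: "i < Suc j" "j' \<le> k" "k < length B"
  have "row_le (A ! i) (B ! j')"
    using row_words_nth[OF assms(1), of i j] row_le_trans assms(3,5) * by (cases "i = j") auto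
  then show "row_le (A ! i) (B ! k)"
    using row_words_nth[OF assms(2), of j' k] row_le_trans * by (cases "k = j'") auto
qed

lemma row_words_splice_not_le:
  assumes "A \<in> row_words" "B \<in> row_words" "j \<le> length B"
    and "\<And>i. i < j \<Longrightarrow> \<not> row_le (B ! i) (A ! i)"
  shows "take j A @ drop (Suc j) B \<in> row_words"
proof (rule row_words_splice[OF assms(1,2)])
  fix i k assume "i < j" "Suc j \<le> k" "k < length B"
  then show "row_le (A ! i) (B ! k)"
    using assms(4)[of i] row_words_nth[OF assms(2), of i k] by (auto intro: not_row_le_trans)
qed

text \<open>The violation \<open>row_le (B ! j) (A ! j)\<close> is what joins the new first row; the
  unviolated columns before \<open>j\<close> join the new second row. The first row gains one letter
  and the second loses one, so the gap grows by 2.\<close>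

lemma swap_tails_first_crossing:
  assumes "(A, B) \<in> wide_pairs d" "crosses A B j" "\<And>i. i < j \<Longrightarrow> \<not> crosses A B i"
    and swap: "swap_tails j (A, B) = (A', B')"
  shows "(A', B') \<in> wide_pairs (d + 2)" "unswap_tails j (A', B') = (A, B)"
    "recrosses A' B' j" "\<And>i. i < j \<Longrightarrow> \<not> recrosses A' B' i"
    "pair_weight (A', B') = pair_weight (A, B)"
proof -
  have AB: "A \<in> row_words" "B \<in> row_words" "length B + d \<le> length A"
    and j: "j < length B" "row_le (B ! j) (A ! j)"
    and before: "\<And>i. i < j \<Longrightarrow> \<not> row_le (B ! i) (A ! i)"
    using assms(1-3) by (fastforce simp: wide_pairs_def crosses_def)+
  have A': "A' = take (Suc j) B @ drop j A" and B': "B' = take j A @ drop (Suc j) B"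
    using swap by (auto simp: swap_tails_def)
  have "A' \<in> row_words" "B' \<in> row_words"
    unfolding A' B' using AB j before by (auto intro: row_words_splice_le row_words_splice_not_le)
  then show "(A', B') \<in> wide_pairs (d + 2)"
    using AB j by (auto simp: wide_pairs_def A' B')
  show "unswap_tails j (A', B') = (A, B)"
    using AB j by (simp add: unswap_tails_def A' B' min_def)
  \<comment> \<open>In column \<open>j\<close> the new rows show \<open>B ! j\<close> over
    \<open>B ! Suc j\<close>, or the second row has ended. In earlier columns \<open>A\<close> and
    \<open>B\<close> have merely traded places, so a recrossing there would be an earlier
    crossing.\<close>
  show "recrosses A' B' j"
    using AB j row_words_nth[of B j "Suc j"]
    by (auto simp: recrosses_def A' B' nth_append min_def)
  show "\<not> recrosses A' B' i" if "i < j" for i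
    using AB j that before[OF that] by (auto simp: recrosses_def A' B' nth_append min_def)
  have "word_weight (take j A) + word_weight (drop j A) = word_weight A"
    "word_weight (take (Suc j) B) + word_weight (drop (Suc j) B) = word_weight B"
    by (simp_all flip: word_weight_simps(3))
  then show "pair_weight (A', B') = pair_weight (A, B)"
    by (simp add: pair_weight_def A' B')
qed

lemma unswap_tails_first_recrossing:
  assumes "(A, B) \<in> wide_pairs (d + 2)" "recrosses A B j" "\<And>i. i < j \<Longrightarrow> \<not> recrosses A B i"
    and unswap: "unswap_tails j (A, B) = (A', B')"
  shows "(A', B') \<in> wide_pairs d" "swap_tails j (A', B') = (A, B)"
    "crosses A' B' j" "\<And>i. i < j \<Longrightarrow> \<not> crosses A' B' i"
proof -
  have AB: "A \<in> row_words" "B \<in> row_words" "length B + d + 2 \<le> length A"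
    and j: "j < length B \<Longrightarrow> row_le (A ! j) (B ! j)"
    and before: "\<And>i. i < j \<Longrightarrow> i < length B" "\<And>i. i < j \<Longrightarrow> \<not> row_le (A ! i) (B ! i)"
    using assms(1-3) by (fastforce simp: wide_pairs_def recrosses_def)+
  have jB: "j \<le> length B"
    using before(1)[of "j - 1"] by (cases j) auto
  have A': "A' = take j B @ drop (Suc j) A" and B': "B' = take (Suc j) A @ drop j B"
    using unswap by (auto simp: unswap_tails_def)
  have "A' \<in> row_words"
    unfolding A' using AB jB before(2) by (auto intro: row_words_splice_not_le)
  \<comment> \<open>At the boundary \<open>j = length B\<close> there is no tail of \<open>B\<close>
    to append, and the new second row is just a prefix of \<open>A\<close>.\<close>
  moreover have "B' \<in> row_words"
  proof (cases "j < length B")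
    case True
    then show ?thesis
      unfolding B' using AB j by (auto intro: row_words_splice_le)
  next
    case False
    then show ?thesis
      using AB(1) by (simp add: B' row_words_def sorted_wrt_take)
  qed
  ultimately show "(A', B') \<in> wide_pairs d"
    using AB jB by (auto simp: wide_pairs_def A' B')
  show "swap_tails j (A', B') = (A, B)"
    using AB jB by (simp add: swap_tails_def A' B' min_def)
  \<comment> \<open>Column \<open>j\<close> now shows \<open>A ! Suc j\<close> over
    \<open>A ! j\<close>, a violation; \<open>Suc j\<close> is within \<open>A\<close> because the
    gap is at least 2.\<close>
  show "crosses A' B' j"
    using AB jB row_words_nth[of A j "Suc j"]
    by (auto simp: crosses_def A' B' nth_append min_def)
  show "\<not> crosses A' B' i" if "i < j" for i
    using AB jB that before(2)[OF that] by (auto simp: crosses_def A' B' nth_append min_def)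
qed

lemma Least_nat_equality:
  "P j \<Longrightarrow> (\<And>i. i < j \<Longrightarrow> \<not> P i) \<Longrightarrow> (LEAST j. P j) = (j :: nat)"
  by (metis LeastI linorder_neqE_nat not_less_Least)

text \<open>The exchange makes its own position the first recrossing, and conversely, so each map
  finds the index used by the other.\<close>

lemma bij_betw_swap_tails:
  "bij_betw (\<lambda>(A, B). swap_tails (LEAST j. crosses A B j) (A, B))
     (wide_pairs d - tableaux d) (wide_pairs (d + 2))" (is "bij_betw ?f _ _")
proof (rule bij_betw_byWitness)
  let ?g = "\<lambda>(A, B). unswap_tails (LEAST j. recrosses A B j) (A, B)"
  let ?S = "wide_pairs d - tableaux d" and ?T = "wide_pairs (d + 2)"
  have f: "?f (A, B) \<in> ?T \<and> ?g (?f (A, B)) = (A, B)" if "(A, B) \<in> ?S" for A B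
  proof -
    have AB: "(A, B) \<in> wide_pairs d" "\<exists>j. crosses A B j"
      using that by (auto simp: tableaux_def)
    define j where "j = (LEAST j. crosses A B j)"
    have j: "crosses A B j" "\<And>i. i < j \<Longrightarrow> \<not> crosses A B i"
      unfolding j_def using AB(2) by (auto intro: LeastI_ex dest: not_less_Least)
    obtain A' B' where swap: "swap_tails j (A, B) = (A', B')"
      by fastforce
    note * = swap_tails_first_crossing[OF AB(1) j swap]
    have "(LEAST j. recrosses A' B' j) = j"
      using *(3,4) by (rule Least_nat_equality)
    then show ?thesis
      using *(1,2) swap by (simp flip: j_def)
  qed
  have g: "?g (A, B) \<in> ?S \<and> ?f (?g (A, B)) = (A, B)" if AB: "(A, B) \<in> ?T" for A B
  proof -
    define j where "j = (LEAST j. recrosses A B j)"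
    have "recrosses A B (length B)"
      by (simp add: recrosses_def)
    then have j: "recrosses A B j" "\<And>i. i < j \<Longrightarrow> \<not> recrosses A B i"
      unfolding j_def by (auto intro: LeastI dest: not_less_Least)
    obtain A' B' where unswap: "unswap_tails j (A, B) = (A', B')"
      by fastforce
    note * = unswap_tails_first_recrossing[OF AB j unswap]
    have "(LEAST j. crosses A' B' j) = j"
      using *(3,4) by (rule Least_nat_equality)
    then show ?thesis
      using *(1-3) unswap by (auto simp: tableaux_def simp flip: j_def)
  qed
  have f': "?f p \<in> ?T \<and> ?g (?f p) = p" if "p \<in> ?S" for p
    using f[of "fst p" "snd p"] that by simp
  have g': "?g p \<in> ?S \<and> ?f (?g p) = p" if "p \<in> ?T" for p
    using g[of "fst p" "snd p"] that by simp
  show "\<forall>p\<in>?S. ?g (?f p) = p" "\<forall>p\<in>?T. ?f (?g p) = p"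
    using f' g' by blast+
  show "?f ` ?S \<subseteq> ?T" "?g ` ?T \<subseteq> ?S"
    using f' g' by (auto simp only: image_subset_iff)
qed

lemma finite_fibres_pair_weight: "finite_fibres pair_weight S"
proof -
  have "finite_fibres pair_weight (UNIV \<times> UNIV)"
    unfolding pair_weight_def by (intro finite_fibres_times finite_fibres_word_weight)
  then show ?thesis
    by (rule finite_fibres_subset) auto
qed

lemma weight_gf_tableaux:
  "weight_gf pair_weight (tableaux d)
    = (weight_gf pair_weight (row_pairs d) + weight_gf pair_weight (row_pairs (Suc d))
        :: 'a::field_char_0 fps)"
proof -
  let ?G = "weight_gf pair_weight :: _ \<Rightarrow> 'a fps"
  have "?G (wide_pairs (d + 2)) = ?G (wide_pairs d - tableaux d)"
  proof (rule weight_gf_bij_betw[OF bij_betw_swap_tails])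
    fix p assume p: "p \<in> wide_pairs d - tableaux d"
    obtain A B where AB: "p = (A, B)" by fastforce
    have ex: "\<exists>j. crosses A B j" "(A, B) \<in> wide_pairs d"
      using p by (auto simp: AB tableaux_def)
    obtain A' B' where swap: "swap_tails (LEAST j. crosses A B j) (A, B) = (A', B')"
      by fastforce
    have "pair_weight (A', B') = pair_weight (A, B)"
      by (rule swap_tails_first_crossing(5)[OF ex(2) _ _ swap])
        (use ex(1) in \<open>auto intro: LeastI_ex dest: not_less_Least\<close>)
    then show "pair_weight (case p of (A, B) \<Rightarrow> swap_tails (LEAST j. crosses A B j) (A, B))
        = pair_weight p"
      by (simp add: AB swap)
  qed
  moreover have "?G (tableaux d \<union> (wide_pairs d - tableaux d))
      = ?G (tableaux d) + ?G (wide_pairs d - tableaux d)"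
    by (intro weight_gf_Un finite_fibres_pair_weight) auto
  \<comment> \<open>\<open>wide_pairs d\<close> is split in two ways: by absence or presence of a
    violation, and by gap \<open>d\<close>, \<open>d + 1\<close> or at least \<open>d + 2\<close>.
    The violating pairs cancel against the last class.\<close>
  moreover have "tableaux d \<union> (wide_pairs d - tableaux d)
      = (row_pairs d \<union> row_pairs (Suc d)) \<union> wide_pairs (d + 2)"
    by (auto simp: tableaux_def wide_pairs_def row_pairs_def)
  moreover have "?G ((row_pairs d \<union> row_pairs (Suc d)) \<union> wide_pairs (d + 2))
      = ?G (row_pairs d \<union> row_pairs (Suc d)) + ?G (wide_pairs (d + 2))"
    by (intro weight_gf_Un finite_fibres_pair_weight) (auto simp: wide_pairs_def row_pairs_def)
  moreover have "?G (row_pairs d \<union> row_pairs (Suc d)) = ?G (row_pairs d) + ?G (row_pairs (Suc d))"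
    by (intro weight_gf_Un finite_fibres_pair_weight) (auto simp: row_pairs_def)
  ultimately show ?thesis by simp
qed

section \<open>Recurrences for pairs of rows\<close>

text \<open>\<open>row_words_decomp\<close> applied to one row \<open>A\<close> beside a spectator
  \<open>c\<close>. \<open>Q\<close> links \<open>c\<close> to the length of the row; the pieces
  that lose a letter see it at \<open>Suc (length A)\<close>, and the shifted pieces pay
  \<open>2 * length A\<close>.\<close>

lemma weight_gf_row_decomp:
  fixes v :: "'c \<Rightarrow> nat"
  assumes "finite_fibres v C"
  shows "weight_gf (\<lambda>(c, A). v c + word_weight A) {(c, A). c \<in> C \<and> A \<in> row_words \<and> Q c (length A)}
    = (fps_X * weight_gf (\<lambda>(c, A). v c + word_weight A)
          {(c, A). c \<in> C \<and> A \<in> row_words \<and> Q c (Suc (length A))}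
      + weight_gf (\<lambda>(c, A). v c + word_weight A + 2 * length A)
          {(c, A). c \<in> C \<and> A \<in> row_words \<and> Q c (length A)}
      + fps_X ^ 2 * weight_gf (\<lambda>(c, A). v c + word_weight A + 2 * length A)
          {(c, A). c \<in> C \<and> A \<in> row_words \<and> Q c (Suc (length A))} :: 'a::field_char_0 fps)"
proof -
  let ?w = "\<lambda>(c, A). v c + word_weight A"
  let ?S = "{(c, A). c \<in> C \<and> A \<in> row_words \<and> Q c (length A)}"
  let ?T = "{(c, A). c \<in> C \<and> A \<in> row_words \<and> Q c (Suc (length A))}"
  let ?on = "\<lambda>f (c :: 'c, A). (c, f A :: (nat + nat) list)"
  have fin: "finite_fibres ?w U" if "U \<subseteq> C \<times> UNIV" for U
    using finite_fibres_times[OF assms finite_fibres_word_weight] that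
    by (rule finite_fibres_subset)
  have decomp: "?S = (?on ((#) (Inl 0)) ` ?T \<union> ?on (map up) ` ?S) \<union> ?on insert_fermion ` ?T"
    (is "_ = (?S1 \<union> ?S2) \<union> ?S3")
  proof (intro equalityI subsetI)
    fix p assume p: "p \<in> ?S"
    obtain c A where cA: "p = (c, A)" by fastforce
    have "A \<in> (#) (Inl 0) ` row_words \<union> map up ` row_words \<union> insert_fermion ` row_words"
      using p row_words_decomp by (simp add: cA)
    then consider B where "B \<in> row_words" "A = Inl 0 # B" | B where "B \<in> row_words" "A = map up B"
      | B where "B \<in> row_words" "A = insert_fermion B"
      by blast
    then show "p \<in> (?S1 \<union> ?S2) \<union> ?S3"
    proof cases
      case 1
      then have "(c, B) \<in> ?T" "p = ?on ((#) (Inl 0)) (c, B)"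
        using p by (auto simp: cA)
      then show ?thesis by blast
    next
      case 2
      then have "(c, B) \<in> ?S" "p = ?on (map up) (c, B)"
        using p by (auto simp: cA)
      then show ?thesis by blast
    next
      case 3
      then have "(c, B) \<in> ?T" "p = ?on insert_fermion (c, B)"
        using p by (auto simp: cA)
      then show ?thesis by blast
    qed
  qed (auto simp: insert_fermion_row_words)
  have disj: "?S1 \<inter> ?S2 = {}"
    using row_words_decomp_disjoint(1) by (auto simp: disjoint_iff)
  have disj': "(?S1 \<union> ?S2) \<inter> ?S3 = {}"
  proof (rule equals0I)
    fix p assume p: "p \<in> (?S1 \<union> ?S2) \<inter> ?S3"
    have image: "snd p \<in> f ` row_words" if "p \<in> ?on f ` Z" "Z \<subseteq> UNIV \<times> row_words" for f Z
      using that by auto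
    have sub: "?T \<subseteq> UNIV \<times> row_words" "?S \<subseteq> UNIV \<times> row_words"
      by auto
    have "snd p \<in> (#) (Inl 0) ` row_words \<union> map up ` row_words"
      using IntD1[OF p]
    proof
      assume "p \<in> ?S1"
      then show ?thesis by (rule UnI1[OF image[OF _ sub(1)]])
    next
      assume "p \<in> ?S2"
      then show ?thesis by (rule UnI2[OF image[OF _ sub(2)]])
    qed
    moreover have "snd p \<in> insert_fermion ` row_words"
      by (rule image[OF IntD2[OF p] sub(1)])
    ultimately have "snd p \<in> ((#) (Inl 0) ` row_words \<union> map up ` row_words) \<inter> insert_fermion ` row_words"
      by (rule IntI)
    then show False
      unfolding row_words_decomp_disjoint(2) by simp
  qed
  have sub: "?S1 \<subseteq> C \<times> UNIV" "?S2 \<subseteq> C \<times> UNIV" "?S3 \<subseteq> C \<times> UNIV"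
    by auto
  have "weight_gf ?w ?S = (weight_gf ?w ((?S1 \<union> ?S2) \<union> ?S3) :: 'a fps)"
    by (rule arg_cong[OF decomp])
  also have "\<dots> = weight_gf ?w (?S1 \<union> ?S2) + weight_gf ?w ?S3"
    by (rule weight_gf_Un[OF fin[OF Un_least[OF sub(1,2)]] fin[OF sub(3)] disj'])
  also have "weight_gf ?w (?S1 \<union> ?S2) = (weight_gf ?w ?S1 + weight_gf ?w ?S2 :: 'a fps)"
    by (rule weight_gf_Un[OF fin[OF sub(1)] fin[OF sub(2)] disj])
  also have "weight_gf ?w ?S1 = (fps_X ^ 1 * weight_gf ?w ?T :: 'a fps)"
    by (rule weight_gf_inj_image) (auto simp: inj_on_def)
  also have "weight_gf ?w ?S2
      = (fps_X ^ 0 * weight_gf (\<lambda>(c, A). v c + word_weight A + 2 * length A) ?S :: 'a fps)"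
    by (rule weight_gf_inj_image) (auto simp: inj_on_def inj_map_eq_map[OF inj_up])
  also have "weight_gf ?w ?S3
      = (fps_X ^ 2 * weight_gf (\<lambda>(c, A). v c + word_weight A + 2 * length A) ?T :: 'a fps)"
    by (rule weight_gf_inj_image)
      (auto simp: word_weight_insert_fermion inj_on_def dest: inj_onD[OF inj_on_insert_fermion])
  finally show ?thesis by simp
qed

text \<open>Weight of a pair whose second row has been shifted by \<open>up\<close>.\<close>

definition long_weight :: "(nat + nat) list \<times> (nat + nat) list \<Rightarrow> nat" where
  "long_weight = (\<lambda>(A, B). word_weight A + word_weight B + 2 * length B)"

text \<open>\<open>corr d\<close> is the coefficient of \<open>z\<^sup>d\<close> in \<open>H(z) H(1/z)\<close>.\<close>

definition corr :: "nat \<Rightarrow> 'a::field_char_0 fps" where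
  "corr d = weight_gf pair_weight (row_pairs d)"

definition corr_long :: "nat \<Rightarrow> 'a::field_char_0 fps" where
  "corr_long d = weight_gf long_weight (row_pairs d)"

text \<open>The second row is decomposed; a letter lost there widens the gap from \<open>d\<close>
  to \<open>Suc d\<close>.\<close>

lemma corr_second_row: "corr d = fps_X * corr (Suc d) + corr_long d + fps_X ^ 2 * corr_long (Suc d)"
  using weight_gf_row_decomp[OF finite_fibres_word_weight, of row_words "\<lambda>A n. length A = n + d"]
  unfolding corr_def corr_long_def row_pairs_def pair_weight_def long_weight_def by simp

text \<open>Here the first row is decomposed, so a lost letter narrows the gap.\<close>

lemma corr_first_row:
  "corr (Suc d) = fps_X * corr d + fps_X ^ (2 * d + 2) * (corr_long (Suc d) + corr_long d)"
proof -
  let ?S = "\<lambda>d. {(B, A). B \<in> row_words \<and> A \<in> row_words \<and> length A = length B + d}"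
  let ?v = "\<lambda>(B, A). word_weight B + word_weight A + 2 * length A"
  \<comment> \<open>The components are swapped because \<open>weight_gf_row_decomp\<close> acts on
    the second one.\<close>
  have swap: "?S d = prod.swap ` row_pairs d" for d
    by (auto simp: row_pairs_def image_iff)
  have corr: "weight_gf (\<lambda>(B, A). word_weight B + word_weight A) (?S d) = (corr d :: 'a fps)" for d
  proof -
    have "weight_gf (\<lambda>(B, A). word_weight B + word_weight A) (?S d)
        = (fps_X ^ 0 * corr d :: 'a fps)"
      unfolding swap corr_def by (rule weight_gf_inj_image) (auto simp: pair_weight_def)
    then show ?thesis by simp
  qed
  \<comment> \<open>In a pair of gap \<open>d\<close> the first row is longer by \<open>d\<close>,
    so shifting it instead of the second row costs an extra \<open>fps_X ^ (2 * d)\<close>.\<close>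
  have long: "weight_gf ?v (?S d) = (fps_X ^ (2 * d) * corr_long d :: 'a fps)" for d
    unfolding swap corr_long_def
    by (rule weight_gf_inj_image) (auto simp: long_weight_def row_pairs_def)
  have "weight_gf (\<lambda>(B, A). word_weight B + word_weight A) (?S (Suc d))
      = (fps_X * weight_gf (\<lambda>(B, A). word_weight B + word_weight A) (?S d)
         + weight_gf ?v (?S (Suc d)) + fps_X ^ 2 * weight_gf ?v (?S d) :: 'a fps)"
    using weight_gf_row_decomp[OF finite_fibres_word_weight, of row_words "\<lambda>B n. n = length B + Suc d"]
    by simp
  then show ?thesis
    unfolding corr long by (simp add: algebra_simps power_add power2_eq_square)
qed

lemma corr_step:
  "(1 + fps_X ^ (2 * d + 3)) * (corr (Suc d) + corr (Suc (Suc d)))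
    = (fps_X * (1 + fps_X ^ (2 * d + 1)) * (corr d + corr (Suc d)) :: 'a::field_char_0 fps)"
proof -
  \<comment> \<open>The factor \<open>y\<close> is chosen to eliminate \<open>corr_long\<close>:
    \<open>corr_long (Suc (Suc d))\<close> drops out of \<open>E1\<close>,
    \<open>corr_long d\<close> out of \<open>E2\<close>, and what remains is
    \<open>y * (1 - fps_X ^ 2) * corr_long (Suc d)\<close> with opposite signs.\<close>
  define y :: "'a fps" where "y = fps_X ^ (2 * d + 2)"
  have first: "corr (Suc (Suc d))
      = fps_X * corr (Suc d) + fps_X ^ 2 * y * (corr_long (Suc (Suc d)) + corr_long (Suc d))"
    using corr_first_row[of "Suc d", where 'a = 'a]
    by (simp add: y_def power_add power2_eq_square mult.assoc)
  have E1: "y * corr (Suc d) - corr (Suc (Suc d))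
      = y * (fps_X * corr (Suc (Suc d)) + corr_long (Suc d) + fps_X ^ 2 * corr_long (Suc (Suc d)))
        - (fps_X * corr (Suc d) + fps_X ^ 2 * y * (corr_long (Suc (Suc d)) + corr_long (Suc d)))"
    by (rule arg_cong2[where f = "\<lambda>a b. y * a - b", OF corr_second_row first])
  have E2: "y * corr d - corr (Suc d)
      = y * (fps_X * corr (Suc d) + corr_long d + fps_X ^ 2 * corr_long (Suc d))
        - (fps_X * corr d + y * (corr_long (Suc d) + corr_long d))"
    unfolding y_def
    by (rule arg_cong2[where f = "\<lambda>a b. fps_X ^ (2 * d + 2) * a - b", OF corr_second_row corr_first_row])
  from arg_cong2[where f = "(+)", OF E1 E2]
  have "(1 + fps_X * y) * (corr (Suc d) + corr (Suc (Suc d)))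
      = (fps_X + y) * (corr d + corr (Suc d))"
    by (simp add: algebra_simps)
  moreover have "fps_X * y = fps_X ^ (2 * d + 3)" "fps_X + y = fps_X * (1 + fps_X ^ (2 * d + 1))"
    by (simp_all add: y_def algebra_simps power_add power2_eq_square power3_eq_cube)
  ultimately show ?thesis by simp
qed

lemma corr_closed:
  "(1 + fps_X ^ (2 * d + 1)) * (corr d + corr (Suc d))
    = (fps_X ^ d * (1 + fps_X) * (corr 0 + corr 1) :: 'a::field_char_0 fps)"
proof (induction d)
  case (Suc d)
  have "2 * Suc d + 1 = 2 * d + 3" by simp
  then have "(1 + fps_X ^ (2 * Suc d + 1)) * (corr (Suc d) + corr (Suc (Suc d)))
      = fps_X * ((1 + fps_X ^ (2 * d + 1)) * (corr d + corr (Suc d)) :: 'a fps)"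
    using corr_step[of d] by (simp only: mult.assoc)
  also have "\<dots> = fps_X ^ Suc d * (1 + fps_X) * (corr 0 + corr 1)"
    unfolding Suc.IH by (simp add: mult.assoc)
  finally show ?case .
qed simp

section \<open>Generating function of a single row\<close>

definition row_gf :: "nat \<Rightarrow> 'a::field_char_0 fps" where
  "row_gf n = weight_gf word_weight {A \<in> row_words. length A = n}"

lemma row_gf_0 [simp]: "row_gf 0 = 1"
proof (rule fps_ext)
  fix n
  have "{s \<in> {A \<in> row_words. length A = 0}. word_weight s = n} = (if n = 0 then {[]} else {})"
    by (auto simp: row_words_def)
  then show "fps_nth (row_gf 0) n = fps_nth (1 :: 'a fps) n"
    unfolding row_gf_def weight_gf_nth by simp
qed

lemma row_gf_Suc:
  "(1 - fps_X ^ (2 * n + 2)) * row_gf (Suc n)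
    = (fps_X * (1 + fps_X ^ (2 * n + 1)) * row_gf n :: 'a::field_char_0 fps)"
proof -
  \<comment> \<open>The spectator is trivial, so the decomposition applies to a lone row.\<close>
  let ?S = "\<lambda>n. {(c :: unit, A). c \<in> UNIV \<and> A \<in> row_words \<and> length A = n}"
  have unit: "?S n = Pair () ` {A \<in> row_words. length A = n}" for n
    by auto
  have short: "weight_gf (\<lambda>(c, A). 0 + word_weight A) (?S n) = (row_gf n :: 'a fps)" for n
  proof -
    have "weight_gf (\<lambda>(c, A). 0 + word_weight A) (?S n) = (fps_X ^ 0 * row_gf n :: 'a fps)"
      unfolding unit row_gf_def by (rule weight_gf_inj_image) (auto simp: inj_on_def)
    then show ?thesis by simp
  qed
  have long: "weight_gf (\<lambda>(c, A). 0 + word_weight A + 2 * length A) (?S n)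
      = (fps_X ^ (2 * n) * row_gf n :: 'a fps)" for n
    unfolding unit row_gf_def by (rule weight_gf_inj_image) (auto simp: inj_on_def)
  have "finite_fibres (\<lambda>_. 0) (UNIV :: unit set)"
    by (simp add: finite_fibres_def)
  from weight_gf_row_decomp[OF this, of "\<lambda>_ m. m = Suc n", where 'a = 'a]
  have "row_gf (Suc n) = (fps_X * row_gf n + fps_X ^ (2 * Suc n) * row_gf (Suc n)
      + fps_X ^ 2 * (fps_X ^ (2 * n) * row_gf n) :: 'a fps)"
    unfolding nat.inject short long .
  then show ?thesis
    by (simp add: algebra_simps power_add power2_eq_square)
qed

section \<open>The normalising constant\<close>

text \<open>Congruence modulo \<open>fps_X ^ n\<close> plays the role of X-adic approximation in
  this section.\<close>

lemma fps_X_power_dvd_iff: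
  "fps_X ^ n dvd (f :: 'a::field_char_0 fps) \<longleftrightarrow> (\<forall>k<n. fps_nth f k = 0)"
proof
  assume "fps_X ^ n dvd f"
  then show "\<forall>k<n. fps_nth f k = 0"
    by (auto simp: dvd_def fps_X_power_mult_nth)
next
  assume *: "\<forall>k<n. fps_nth f k = 0"
  have "f = fps_X ^ n * fps_shift n f"
    using * by (intro fps_ext) (simp add: fps_X_power_mult_nth)
  then show "fps_X ^ n dvd f"
    by (rule dvdI)
qed

lemma fps_eq_0_if_fps_X_power_dvd:
  "(\<And>n. fps_X ^ n dvd (f :: 'a::field_char_0 fps)) \<Longrightarrow> f = 0"
  by (metis fps_X_power_dvd_iff fps_ext fps_zero_nth lessI)

lemma fps_X_power_dvd_weight_gf:
  "(\<And>s. s \<in> S \<Longrightarrow> n \<le> w s) \<Longrightarrow> fps_X ^ n dvd (weight_gf w S :: 'a::field_char_0 fps)"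
proof -
  assume "\<And>s. s \<in> S \<Longrightarrow> n \<le> w s"
  then have "{s \<in> S. w s = k} = {}" if "k < n" for k
    using that by fastforce
  then show ?thesis
    unfolding fps_X_power_dvd_iff weight_gf_nth
    by (intro allI impI) (simp only: card.empty of_nat_0)
qed

text \<open>Factor \<open>k\<close> is 1 modulo \<open>fps_X ^ Suc k\<close>, so it cannot affect
  coefficients up to \<open>k\<close>: coefficient \<open>k\<close> is final after the first
  \<open>k\<close> factors.\<close>

lemma fps_prod_limit:
  fixes f :: "nat \<Rightarrow> 'a::field_char_0 fps"
  assumes f: "\<And>k. fps_X ^ Suc k dvd f k - 1"
  obtains p where "\<And>n. fps_X ^ n dvd p - (\<Prod>k<n. f k)" "fps_nth p 0 = 1"
proof
  define p where "p = Abs_fps (\<lambda>k. fps_nth (\<Prod>i<Suc k. f i) k)"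
  have step: "fps_nth (\<Prod>i<Suc m. f i) k = fps_nth (\<Prod>i<m. f i) k" if "k \<le> m" for k m
  proof -
    have "(\<Prod>i<Suc m. f i) - (\<Prod>i<m. f i) = (\<Prod>i<m. f i) * (f m - 1)"
      by (simp add: algebra_simps)
    then have "fps_X ^ Suc m dvd (\<Prod>i<Suc m. f i) - (\<Prod>i<m. f i)"
      using f[of m] by (metis dvd_mult)
    then have "fps_nth ((\<Prod>i<Suc m. f i) - (\<Prod>i<m. f i)) k = 0"
      using that unfolding fps_X_power_dvd_iff by auto
    then show ?thesis by (simp del: prod.lessThan_Suc)
  qed
  have stable: "fps_nth (\<Prod>i<m. f i) k = fps_nth p k" if "k < m" for k m
    using that
  proof (induction m)
    case (Suc m)
    then show ?case
      by (cases "k = m") (auto simp: p_def step simp del: prod.lessThan_Suc)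
  qed simp
  then show "fps_X ^ n dvd p - (\<Prod>k<n. f k)" for n
    by (simp add: fps_X_power_dvd_iff)
  have "fps_nth p 0 = fps_nth (\<Prod>i<0. f i) 0"
    using step[of 0 0] by (simp add: p_def)
  then show "fps_nth p 0 = 1" by simp
qed

text \<open>\<open>has_prod\<close> accepts the limit of the partial products directly as the value
  only when it is nonzero.\<close>

lemma prodinf_fps_eqI:
  fixes f :: "nat \<Rightarrow> 'a::field_char_0 fps"
  assumes "\<And>n. fps_X ^ n dvd p - (\<Prod>k<n. f k)" "p \<noteq> 0"
  shows "(\<Prod>k. f k) = p"
proof -
  have "(\<lambda>n. \<Prod>k\<le>n. f k) \<longlonglongrightarrow> p"
  proof (rule tendsto_fpsI)
    fix n
    have "fps_nth (\<Prod>k\<le>m. f k) n = fps_nth p n" if "n \<le> m" for m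
      using assms(1)[of "Suc m"] that unfolding fps_X_power_dvd_iff lessThan_Suc_atMost by simp
    then show "\<forall>\<^sub>F m in sequentially. fps_nth (\<Prod>k\<le>m. f k) n = fps_nth p n"
      by (auto simp: eventually_sequentially)
  qed
  then have "f has_prod p"
    using assms(2) by (simp add: has_prod_def raw_has_prod_def)
  then show ?thesis
    by (rule has_prod_unique[symmetric])
qed

section \<open>Closed form and limit of the row series\<close>

text \<open>The series g_n: the first \<open>n\<close> factors of numerator and denominator in the
  square root of \<open>q_product\<close>.\<close>

definition row_ratio :: "nat \<Rightarrow> 'a::field_char_0 fps" where
  "row_ratio n = (\<Prod>k<n. 1 + q_r k) * inverse (\<Prod>k<n. 1 - q_n k)"

lemma fps_nth_prod_0: "fps_nth (prod f A) 0 = (\<Prod>k\<in>A. fps_nth (f k :: 'a::comm_ring_1 fps) 0)"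
  by (induction A rule: infinite_finite_induct) auto

lemma prod_q_n_unit: "fps_nth (\<Prod>k<n. 1 - q_n k :: 'a::field_char_0 fps) 0 = 1"
  by (simp add: fps_nth_prod_0 q_n_def)

lemma row_ratio_0 [simp]: "row_ratio 0 = 1"
  by (simp add: row_ratio_def)

lemma row_ratio_mult: "row_ratio n * (\<Prod>k<n. 1 - q_n k) = (\<Prod>k<n. 1 + q_r k :: 'a::field_char_0 fps)"
  using inverse_mult_eq_1[of "\<Prod>k<n. 1 - q_n k :: 'a fps"] prod_q_n_unit[of n, where 'a = 'a]
  by (simp add: row_ratio_def mult.assoc)

lemma row_ratio_Suc:
  "row_ratio (Suc n) * (1 - fps_X ^ (2 * n + 2))
    = (row_ratio n * (1 + fps_X ^ (2 * n + 1)) :: 'a::field_char_0 fps)"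
proof -
  let ?D = "\<Prod>k<n. 1 - q_n k :: 'a fps"
  have "row_ratio (Suc n) * (1 - fps_X ^ (2 * n + 2)) * ?D
      = row_ratio n * (1 + fps_X ^ (2 * n + 1)) * ?D"
    using row_ratio_mult[of "Suc n", where 'a = 'a] row_ratio_mult[of n, where 'a = 'a]
    by (simp add: q_n_def q_r_def algebra_simps)
  moreover have "?D \<noteq> 0"
    using prod_q_n_unit[of n, where 'a = 'a] by (metis fps_zero_nth zero_neq_one)
  ultimately show ?thesis by simp
qed

text \<open>The q-binomial theorem for the rows: both sides satisfy the same first-order recurrence
  in \<open>n\<close> and agree at 0. The factor \<open>1 - fps_X ^ (2 * n + 2)\<close> is cancelled
  as a nonzero power series.\<close>

lemma row_gf_eq: "row_gf n = fps_X ^ n * row_ratio n"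
proof (induction n)
  case (Suc n)
  have "(1 - fps_X ^ (2 * n + 2)) * row_gf (Suc n)
      = (fps_X ^ Suc n * (row_ratio n * (1 + fps_X ^ (2 * n + 1))) :: 'a fps)"
    unfolding row_gf_Suc Suc.IH by (simp only: power_Suc mult_ac)
  also have "\<dots> = (1 - fps_X ^ (2 * n + 2)) * (fps_X ^ Suc n * row_ratio (Suc n))"
    unfolding row_ratio_Suc[symmetric] by (simp only: mult_ac)
  finally have "(1 - fps_X ^ (2 * n + 2)) * row_gf (Suc n)
      = (1 - fps_X ^ (2 * n + 2)) * (fps_X ^ Suc n * row_ratio (Suc n) :: 'a fps)" .
  moreover have "fps_nth (1 - fps_X ^ (2 * n + 2) :: 'a fps) 0 \<noteq> 0"
    by simp
  then have "1 - fps_X ^ (2 * n + 2) \<noteq> (0 :: 'a fps)"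
    by fastforce
  ultimately show ?case by simp
qed simp

text \<open>Adding the term \<open>b = n\<close> turns \<open>1 - fps_X ^ (2 * n)\<close> into
  \<open>1 + fps_X ^ (2 * n + 1)\<close>, and \<open>row_ratio_Suc\<close> trades this for the next
  \<open>row_ratio\<close>.\<close>

lemma sum_row_ratio:
  "(1 + fps_X) * (\<Sum>b<n. fps_X ^ (2 * b) * row_ratio b)
    = (row_ratio n * (1 - fps_X ^ (2 * n)) :: 'a::field_char_0 fps)"
proof (induction n)
  case (Suc n)
  have "(1 + fps_X) * (\<Sum>b<Suc n. fps_X ^ (2 * b) * row_ratio b)
      = (row_ratio n * (1 + fps_X ^ (2 * n + 1)) :: 'a fps)"
    using Suc.IH by (simp add: distrib_left) (simp add: algebra_simps)
  then show ?case
    using row_ratio_Suc[of n, where 'a = 'a] by simp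
qed simp

lemma row_ratio_limit:
  obtains R :: "'a::field_char_0 fps"
  where "\<And>n. fps_X ^ n dvd R - row_ratio n" "R ^ 2 = q_product"
proof -
  have "fps_X ^ Suc k dvd (1 + q_r k) - (1 :: 'a fps)" for k
    unfolding q_r_def add_diff_cancel_left' by (rule le_imp_power_dvd) simp
  moreover have "fps_X ^ Suc k dvd (1 - q_n k) - (1 :: 'a fps)" for k
  proof -
    have "(1 - q_n k) - (1 :: 'a fps) = - (fps_X ^ (2 * (k + 1)))"
      by (simp add: q_n_def)
    then show ?thesis
      by (simp only: dvd_minus_iff) (rule le_imp_power_dvd, simp)
  qed
  ultimately obtain N D :: "'a fps"
    where N: "\<And>n. fps_X ^ n dvd N - (\<Prod>k<n. 1 + q_r k)" "fps_nth N 0 = 1"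
      and D: "\<And>n. fps_X ^ n dvd D - (\<Prod>k<n. 1 - q_n k)" "fps_nth D 0 = 1"
    by (metis fps_prod_limit)
  \<comment> \<open>\<open>q_product\<close> is built from squared factors; a difference of squares
    carries the congruences over to them.\<close>
  have sq: "fps_X ^ n dvd p\<^sup>2 - (\<Prod>k<n. (f k)\<^sup>2)" if "\<And>n. fps_X ^ n dvd p - (\<Prod>k<n. f k)"
    for p :: "'a fps" and f n
  proof -
    have "p\<^sup>2 - (\<Prod>k<n. (f k)\<^sup>2) = (p - (\<Prod>k<n. f k)) * (p + (\<Prod>k<n. f k))"
      by (simp add: prod.distrib power2_eq_square algebra_simps)
    then show ?thesis
      using that[of n] by simp
  qed
  have nz: "N \<noteq> 0" "D \<noteq> 0"
    using N(2) D(2) by auto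
  have prods: "(\<Prod>k. (1 + q_r k)\<^sup>2) = N\<^sup>2" "(\<Prod>k. (1 - q_n k)\<^sup>2) = D\<^sup>2"
    using nz sq[OF N(1)] sq[OF D(1)] by (simp_all add: prodinf_fps_eqI)
  have RD: "N * inverse D * D = N"
    using inverse_mult_eq_1[of D] D(2) by (simp add: mult.assoc)
  show thesis
  proof
    show "(N * inverse D) ^ 2 = q_product"
    proof -
      have "(N * inverse D)\<^sup>2 * D\<^sup>2 = N\<^sup>2"
        using RD by (metis power_mult_distrib)
      then have "N\<^sup>2 / D\<^sup>2 = (N * inverse D)\<^sup>2"
        using nz by (metis nonzero_mult_div_cancel_right power_not_zero)
      then show ?thesis
        by (simp add: q_product_def prods)
    qed
    fix n
    let ?N = "\<Prod>k<n. 1 + q_r k :: 'a fps" and ?D = "\<Prod>k<n. 1 - q_n k :: 'a fps"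
    \<comment> \<open>Multiplying by the unit \<open>D * ?D\<close> clears both denominators,
      leaving the congruences for \<open>N\<close> and \<open>D\<close> separately.\<close>
    have "(N * inverse D - row_ratio n) * (D * ?D)
        = N * inverse D * D * ?D - row_ratio n * ?D * D"
      by (simp add: algebra_simps)
    also have "\<dots> = (N - ?N) * ?D - ?N * (D - ?D)"
      unfolding RD row_ratio_mult by (simp add: algebra_simps)
    finally have "fps_X ^ n dvd (N * inverse D - row_ratio n) * (D * ?D)"
      using N(1)[of n] D(1)[of n] by simp
    moreover have "D * ?D dvd 1"
      using D(2) prod_q_n_unit[of n, where 'a = 'a] by (simp add: fps_is_unit_iff)
    ultimately show "fps_X ^ n dvd N * inverse D - row_ratio n"
      by (simp add: dvd_mult_unit_iff)
  qed
qed

section \<open>Asymptotics of \<open>corr\<close> and its normalisation\<close>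

text \<open>A pair whose second row has at least \<open>n\<close> letters weighs at least
  \<open>n\<close>, so the discarded pairs vanish modulo \<open>fps_X ^ n\<close>.\<close>

lemma corr_truncate:
  "fps_X ^ n dvd corr d - (\<Sum>b<n. row_gf (b + d) * row_gf b :: 'a::field_char_0 fps)"
proof -
  let ?S = "{p \<in> row_pairs d. length (snd p) < n}" and ?T = "{p \<in> row_pairs d. n \<le> length (snd p)}"
  have "weight_gf pair_weight {p \<in> ?S. length (snd p) = b} = (row_gf (b + d) * row_gf b :: 'a fps)"
    if "b < n" for b
  proof -
    have "{p \<in> ?S. length (snd p) = b} = {A \<in> row_words. length A = b + d} \<times> {B \<in> row_words. length B = b}"
      using that by (auto simp: row_pairs_def)
    then show ?thesis
      by (simp add: pair_weight_def row_gf_def weight_gf_times finite_fibres_word_weight)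
  qed
  then have "(\<Sum>b<n. row_gf (b + d) * row_gf b)
      = (\<Sum>b<n. weight_gf pair_weight {p \<in> ?S. length (snd p) = b} :: 'a fps)"
    by simp
  also have "\<dots> = weight_gf pair_weight ?S"
    by (rule sum_weight_gf_fibres) (auto simp: finite_fibres_pair_weight)
  finally have short: "(\<Sum>b<n. row_gf (b + d) * row_gf b :: 'a fps) = weight_gf pair_weight ?S" .
  have "row_pairs d = ?S \<union> ?T"
    by auto
  then have "corr d = (weight_gf pair_weight (?S \<union> ?T) :: 'a fps)"
    by (simp add: corr_def)
  also have "\<dots> = weight_gf pair_weight ?S + weight_gf pair_weight ?T"
    by (intro weight_gf_Un finite_fibres_pair_weight) auto
  finally have "corr d - (\<Sum>b<n. row_gf (b + d) * row_gf b :: 'a fps) = weight_gf pair_weight ?T"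
    using short by simp
  also have "fps_X ^ n dvd (weight_gf pair_weight ?T :: 'a fps)"
  proof (rule fps_X_power_dvd_weight_gf)
    fix p assume "p \<in> ?T"
    then show "n \<le> pair_weight p"
      using length_le_word_weight[of "snd p"] by (auto simp: pair_weight_def case_prod_beta)
  qed
  finally show ?thesis .
qed

text \<open>\<open>corr d\<close> is the sum over \<open>b\<close> of
  \<open>fps_X ^ (2 * b + d) * row_ratio (b + d) * row_ratio b\<close>. Replacing
  \<open>row_ratio (b + d)\<close> by \<open>R\<close> leaves the telescoping sum of
  \<open>sum_row_ratio\<close>.\<close>

lemma corr_asymptotic:
  fixes R :: "'a::field_char_0 fps"
  assumes R: "\<And>n. fps_X ^ n dvd R - row_ratio n"
  shows "fps_X ^ (2 * d) dvd (1 + fps_X) * corr d - fps_X ^ d * R\<^sup>2"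
proof -
  \<comment> \<open>The prefactor \<open>fps_X ^ d\<close> and an error
    \<open>R - row_ratio m\<close> with \<open>d \<le> m\<close>, itself divisible by
    \<open>fps_X ^ d\<close>, together reach order \<open>2 * d\<close>; the truncation is made at
    this order.\<close>
  define n where "n = 2 * d"
  let ?S = "\<Sum>b<n. row_gf (b + d) * row_gf b :: 'a fps"
  have R': "fps_X ^ d dvd R - row_ratio m" if "d \<le> m" for m
    using R[of m] le_imp_power_dvd[OF that] dvd_trans by blast
  have X: "fps_X ^ n = fps_X ^ d * (fps_X ^ d :: 'a fps)"
    by (simp add: n_def mult_2 power_add)
  have square: "fps_X ^ (2 * b) = (fps_X ^ b * fps_X ^ b :: 'a fps)" for b
    by (simp only: mult_2 power_add)
  have "fps_X ^ n dvd (\<Sum>b<n. fps_X ^ d * (fps_X ^ (2 * b) * row_ratio b * (R - row_ratio (b + d))))"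
    unfolding X by (intro dvd_sum mult_dvd_mono dvd_refl dvd_mult R') auto
  also have "(\<Sum>b<n. fps_X ^ d * (fps_X ^ (2 * b) * row_ratio b * (R - row_ratio (b + d))))
      = fps_X ^ d * R * (\<Sum>b<n. fps_X ^ (2 * b) * row_ratio b) - ?S"
    unfolding sum_distrib_left sum_subtractf[symmetric] row_gf_eq square
    by (intro sum.cong refl) (simp only: right_diff_distrib power_add mult_ac)
  finally have "fps_X ^ n dvd (1 + fps_X)
      * (fps_X ^ d * R * (\<Sum>b<n. fps_X ^ (2 * b) * row_ratio b) - ?S)"
    by (rule dvd_mult)
  also have "\<dots> = fps_X ^ d * R * ((1 + fps_X) * (\<Sum>b<n. fps_X ^ (2 * b) * row_ratio b)) - (1 + fps_X) * ?S"
    by (simp add: algebra_simps)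
  finally have 1: "fps_X ^ n dvd fps_X ^ d * R * (row_ratio n * (1 - fps_X ^ (2 * n))) - (1 + fps_X) * ?S"
    unfolding sum_row_ratio .
  have "fps_X ^ n dvd fps_X ^ d * (R * (R - row_ratio n)) + fps_X ^ (2 * n) * (fps_X ^ d * R * row_ratio n)"
  proof (rule dvd_add)
    show "fps_X ^ n dvd fps_X ^ d * (R * (R - row_ratio n))"
      unfolding X by (intro mult_dvd_mono dvd_refl dvd_mult R') (simp add: n_def)
    show "fps_X ^ n dvd fps_X ^ (2 * n) * (fps_X ^ d * R * row_ratio n)"
      by (intro dvd_mult2 le_imp_power_dvd) simp
  qed
  also have "\<dots> = fps_X ^ d * R\<^sup>2 - fps_X ^ d * R * (row_ratio n * (1 - fps_X ^ (2 * n)))"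
    by (simp add: algebra_simps power2_eq_square)
  finally have 2: "fps_X ^ n dvd \<dots>" .
  have 3: "fps_X ^ n dvd (1 + fps_X) * (corr d - ?S)"
    using corr_truncate by (rule dvd_mult)
  \<comment> \<open>Three errors add up: truncating \<open>corr d\<close>, passing to
    \<open>R\<close> inside the sum, and passing to \<open>R\<close> in the telescoped
    value.\<close>
  have split: "(1 + fps_X) * corr d - fps_X ^ d * R\<^sup>2 = (1 + fps_X) * (corr d - ?S)
      - (fps_X ^ d * R * (row_ratio n * (1 - fps_X ^ (2 * n))) - (1 + fps_X) * ?S)
      - (fps_X ^ d * R\<^sup>2 - fps_X ^ d * R * (row_ratio n * (1 - fps_X ^ (2 * n))))"
    by (simp add: right_diff_distrib)
  have "fps_X ^ n dvd (1 + fps_X) * corr d - fps_X ^ d * R\<^sup>2"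
    unfolding split by (rule dvd_diff[OF dvd_diff[OF 3 1] 2])
  then show ?thesis
    by (simp only: n_def)
qed

text \<open>\<open>corr_closed\<close> expresses \<open>fps_X ^ d * (corr 0 + corr 1)\<close>
  through the values at \<open>d\<close> and \<open>Suc d\<close>, which are known modulo
  \<open>fps_X ^ (2 * d)\<close>. Cancelling \<open>fps_X ^ d\<close> still leaves order
  \<open>d\<close>, for every \<open>d\<close>.\<close>

lemma corr_0_1: "(1 + fps_X) * (corr 0 + corr 1) = (q_product :: 'a::field_char_0 fps)"
proof -
  obtain R :: "'a fps" where R: "\<And>n. fps_X ^ n dvd R - row_ratio n" and R2: "R\<^sup>2 = q_product"
    by (rule row_ratio_limit) blast
  let ?E = "(1 + fps_X) * ((1 + fps_X) * (corr 0 + corr 1) - R\<^sup>2) :: 'a fps"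
  have "fps_X ^ d dvd ?E" for d
  proof -
    let ?a = "(1 + fps_X) * corr d - fps_X ^ d * R\<^sup>2 :: 'a fps"
    let ?b = "(1 + fps_X) * corr (Suc d) - fps_X ^ Suc d * R\<^sup>2 :: 'a fps"
    have a: "fps_X ^ (2 * d) dvd ?a"
      by (rule corr_asymptotic[OF R])
    have b: "fps_X ^ (2 * d) dvd ?b"
      using corr_asymptotic[OF R, of "Suc d"] by (rule dvd_trans[OF le_imp_power_dvd, rotated]) simp
    have "fps_X ^ d * ?E
        = (1 + fps_X) * (fps_X ^ d * (1 + fps_X) * (corr 0 + corr 1)) - fps_X ^ d * (1 + fps_X) * R\<^sup>2"
      by (simp add: algebra_simps)
    also have "\<dots> = (1 + fps_X ^ (2 * d + 1)) * (?a + ?b)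
        + fps_X ^ (2 * d) * (fps_X ^ (d + 1) * (1 + fps_X) * R\<^sup>2)"
      unfolding corr_closed[symmetric] by (simp add: algebra_simps power_add)
    also have "fps_X ^ (2 * d) dvd \<dots>"
      using a b by (intro dvd_add dvd_mult dvd_triv_left)
    finally have "fps_X ^ d * fps_X ^ d dvd fps_X ^ d * ?E"
      by (simp only: mult_2 power_add)
    then show ?thesis
      by (subst (asm) dvd_mult_cancel_left) simp
  qed
  then have "?E = 0"
    by (rule fps_eq_0_if_fps_X_power_dvd)
  moreover have "fps_nth (1 + fps_X :: 'a fps) 0 \<noteq> 0"
    by simp
  then have "1 + fps_X \<noteq> (0 :: 'a fps)"
    by fastforce
  ultimately show ?thesis
    using R2 by simp
qed

section \<open>Hook Schur functions of two-row partitions\<close>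

lemma downset_eq_lessThan_card:
  assumes "finite S" "\<And>i j. i \<in> S \<Longrightarrow> j \<le> i \<Longrightarrow> j \<in> S"
  shows "S = {..<card S}"
proof (rule card_subset_eq)
  show "S \<subseteq> {..<card S}"
  proof
    fix i assume "i \<in> S"
    then have "{..i} \<subseteq> S" using assms(2) by auto
    then have "card {..i} \<le> card S" using assms(1) by (rule card_mono[rotated])
    then show "i \<in> {..<card S}" by simp
  qed
qed auto

text \<open>The rows longer than \<open>j\<close> form an initial segment, so their number is the
  first row index outside it.\<close>

lemma less_conjugate_iff:
  assumes "is_partition la"
  shows "i < conjugate la j \<longleftrightarrow> j < la i"
proof -
  have "finite {i. j < la i}"
    by (rule finite_subset[of _ "{i. la i \<noteq> 0}"]) (use assms in \<open>auto simp: is_partition_def\<close>)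
  moreover have "k \<in> {i. j < la i}" if "i \<in> {i. j < la i}" "k \<le> i" for i k
    using that assms by (auto simp: is_partition_def antimono_def intro: less_le_trans)
  ultimately have "{i. j < la i} = {..<conjugate la j}"
    unfolding conjugate_def by (rule downset_eq_lessThan_card)
  then show ?thesis by blast
qed

lemma conjugate_le_iff: "is_partition la \<Longrightarrow> conjugate la j \<le> i \<longleftrightarrow> la i \<le> j"
  using less_conjugate_iff[of la i j] by (simp add: not_less[symmetric])

lemma conjugate_mono:
  assumes "is_partition mu" "is_partition la" "mu \<le> la"
  shows "conjugate mu \<le> conjugate la"
proof (rule le_funI)
  fix j
  have "mu i \<le> la i" for i
    using assms(3) by (simp add: le_fun_def)
  then have "i < conjugate mu j \<Longrightarrow> i < conjugate la j" for i
    using assms(1,2) by (auto simp: less_conjugate_iff intro: less_le_trans)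
  then show "conjugate mu j \<le> conjugate la j"
    using not_less by blast
qed

lemma skew_diagram_conjugate:
  assumes "is_partition mu" "is_partition la"
  shows "skew_diagram (conjugate la) (conjugate mu) = prod.swap ` skew_diagram la mu"
  using assms by (force simp: skew_diagram_def less_conjugate_iff conjugate_le_iff)

text \<open>The weight bounds every entry, and extensionality leaves finitely many bounded
  fillings.\<close>

lemma finite_fibres_ssyt:
  assumes "finite (skew_diagram la mu)" "\<And>k. k \<le> f k"
  shows "finite_fibres (\<lambda>T. \<Sum>c\<in>skew_diagram la mu. f (T c)) (ssyt la mu)"
  unfolding finite_fibres_def
proof
  fix n
  let ?D = "skew_diagram la mu"
  have "{T \<in> ssyt la mu. (\<Sum>c\<in>?D. f (T c)) = n} \<subseteq> PiE ?D (\<lambda>_. {..n})"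
  proof
    fix T assume T: "T \<in> {T \<in> ssyt la mu. (\<Sum>c\<in>?D. f (T c)) = n}"
    have "T c \<le> n" if "c \<in> ?D" for c
    proof -
      have "f (T c) \<le> (\<Sum>c\<in>?D. f (T c))"
        using assms(1) that by (intro member_le_sum) auto
      then show ?thesis
        using assms(2)[of "T c"] T by simp
    qed
    then show "T \<in> PiE ?D (\<lambda>_. {..n})"
      using T by (auto simp: ssyt_def PiE_def)
  qed
  then show "finite {T \<in> ssyt la mu. (\<Sum>c\<in>?D. f (T c)) = n}"
    by (rule finite_subset) (simp add: assms(1) finite_PiE)
qed

lemma skew_schur_fps_X_power:
  assumes "finite (skew_diagram la mu)" "mu \<le> la" "\<And>k. k \<le> f k"
  shows "skew_schur la mu (\<lambda>k. fps_X ^ f k)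
    = (weight_gf (\<lambda>T. \<Sum>c\<in>skew_diagram la mu. f (T c)) (ssyt la mu) :: 'a::field_char_0 fps)"
  using assms(2) infsum_fps_X_power[OF finite_fibres_ssyt[OF assms(1,3)]]
  by (simp add: skew_schur_def power_sum)

section \<open>Hook tableaux as pairs of rows\<close>

text \<open>Rows are indexed by all naturals and empty from the third on, to match partitions as
  functions on \<open>nat\<close>.\<close>

definition two_rows :: "(nat + nat) list \<times> (nat + nat) list \<Rightarrow> nat \<Rightarrow> (nat + nat) list" where
  "two_rows p i = (if i = 0 then fst p else if i = 1 then snd p else [])"

definition outer_shape :: "(nat + nat) list \<times> (nat + nat) list \<Rightarrow> nat \<Rightarrow> nat" where
  "outer_shape p i = length (two_rows p i)"

text \<open>Shape of the cells filled from the first alphabet; it becomes the summation index in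
  \<open>hook_schur\<close>.\<close>

definition inner_shape :: "(nat + nat) list \<times> (nat + nat) list \<Rightarrow> nat \<Rightarrow> nat" where
  "inner_shape p i = length (filter isl (two_rows p i))"

lemma row_words_isl_nth:
  assumes "A \<in> row_words" "j < length A"
  shows "isl (A ! j) \<longleftrightarrow> j < length (filter isl A)"
proof -
  let ?P = "filter isl A" and ?Q = "filter (\<lambda>a. \<not> isl a) A"
  have "A ! j = (?P @ ?Q) ! j" and len: "length A = length ?P + length ?Q"
    using row_words_split[OF assms(1)] by (simp_all flip: length_append)
  moreover have "isl (?P ! j)" if "j < length ?P"
    using nth_mem[OF that] by simp
  moreover have "\<not> isl (?Q ! (j - length ?P))" if "\<not> j < length ?P"
    using nth_mem[of "j - length ?P" ?Q] that assms(2) len by auto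
  ultimately show ?thesis
    by (simp add: nth_append)
qed

lemma two_row_partition:
  assumes "is_partition la" "partition_length la \<le> 2" "2 \<le> i"
  shows "la i = 0"
proof (rule ccontr)
  assume "la i \<noteq> 0"
  moreover have "la i \<le> la j" if "j \<le> i" for j
    using assms(1) that by (simp add: is_partition_def antimono_def)
  ultimately have "la j \<noteq> 0" if "j \<le> 2" for j
    using assms(3) that by (metis le_0_eq le_trans)
  then have "card {..2 :: nat} \<le> partition_length la"
    using assms(1) unfolding partition_length_def is_partition_def by (intro card_mono) auto
  then show False
    using assms(2) by simp
qed

text \<open>Membership is resolved into conditions on single cells and neighbouring cells, the form
  in which semistandardness of two separate fillings can be read off.\<close>

lemma tableaux_outer_shape_iff:
  assumes la: "is_partition la" "partition_length la \<le> 2" and mu: "mu \<le> la"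
  shows "p \<in> tableaux 0 \<and> outer_shape p = la \<and> inner_shape p = mu \<longleftrightarrow>
    (\<forall>i. length (two_rows p i) = la i) \<and>
    (\<forall>i j. j < la i \<longrightarrow> isl (two_rows p i ! j) = (j < mu i)) \<and>
    (\<forall>i j. Suc j < la i \<longrightarrow> row_le (two_rows p i ! j) (two_rows p i ! Suc j)) \<and>
    (\<forall>i j. j < la (Suc i) \<longrightarrow> \<not> row_le (two_rows p (Suc i) ! j) (two_rows p i ! j))"
    (is "?L \<longleftrightarrow> ?len \<and> ?isl \<and> ?row \<and> ?col")
proof
  assume L: ?L
  obtain A B where p: "p = (A, B)" by fastforce
  have len: ?len using L by (auto simp: outer_shape_def)
  have row_words: "two_rows p i \<in> row_words" for i
    using L by (auto simp: two_rows_def p tableaux_def wide_pairs_def row_words_def)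
  have ?isl
    using row_words_isl_nth[OF row_words] len L by (auto simp: inner_shape_def)
  moreover have ?row
    using row_words_nth[OF row_words] len by auto
  moreover have ?col
  proof (intro allI impI)
    fix i j assume j: "j < la (Suc i)"
    then have "i = 0"
      using two_row_partition[OF la, of "Suc i"] by (cases i) auto
    moreover have "j < length B"
      using j len[rule_format, of 1] \<open>i = 0\<close> by (simp add: two_rows_def p)
    ultimately show "\<not> row_le (two_rows p (Suc i) ! j) (two_rows p i ! j)"
      using L by (auto simp: two_rows_def p tableaux_def crosses_def)
  qed
  ultimately show "?len \<and> ?isl \<and> ?row \<and> ?col"
    using len by blast
next
  assume R: "?len \<and> ?isl \<and> ?row \<and> ?col"
  obtain A B where p: "p = (A, B)" by fastforce
  have row_words: "two_rows p i \<in> row_words" for i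
    unfolding row_words_def mem_Collect_eq sorted_wrt_iff_nth_Suc_transp[OF transp_row_le]
    using R by simp
  have AB: "two_rows p 0 = A" "two_rows p (Suc 0) = B"
    by (simp_all add: two_rows_def p)
  have "la 1 \<le> la 0"
    using la(1) by (simp add: is_partition_def antimono_def)
  moreover have "length A = la 0" "length B = la 1"
    using R AB by auto
  moreover have "\<not> row_le (B ! j) (A ! j)" if "j < la 1" for j
    using R AB that by (metis One_nat_def)
  ultimately have "p \<in> tableaux 0"
    using row_words[of 0] row_words[of "Suc 0"]
    by (auto simp: AB tableaux_def wide_pairs_def crosses_def) (auto simp: p tableaux_def wide_pairs_def crosses_def)
  moreover have "outer_shape p = la"
    using R by (auto simp: outer_shape_def)
  moreover have "inner_shape p = mu"
  proof
    fix i
    have "mu i \<le> la i"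
      using mu by (simp add: le_fun_def)
    then have "{j. j < length (two_rows p i) \<and> isl (two_rows p i ! j)} = {..<mu i}"
      using R by fastforce
    then show "inner_shape p i = mu i"
      by (simp add: inner_shape_def length_filter_conv_card)
  qed
  ultimately show ?L by blast
qed

text \<open>\<open>T\<close> fills \<open>mu\<close> itself, whereas \<open>U\<close> lives on the
  conjugate skew shape, hence the transposed argument \<open>U (j, i)\<close>.\<close>

definition glue :: "(nat \<Rightarrow> nat) \<Rightarrow> (nat \<Rightarrow> nat) \<Rightarrow> (nat \<times> nat \<Rightarrow> nat) \<times> (nat \<times> nat \<Rightarrow> nat) \<Rightarrow> nat
    \<Rightarrow> (nat + nat) list" where
  "glue la mu = (\<lambda>(T, U) i. map (\<lambda>j. if j < mu i then Inl (T (i, j)) else Inr (U (j, i))) [0..<la i])"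

lemma ssyt_straight_iff:
  "T \<in> ssyt mu (\<lambda>_. 0) \<longleftrightarrow> T \<in> extensional (skew_diagram mu (\<lambda>_. 0)) \<and>
    (\<forall>i j. Suc j < mu i \<longrightarrow> T (i, j) \<le> T (i, Suc j)) \<and>
    (\<forall>i j. j < mu i \<and> j < mu (Suc i) \<longrightarrow> T (i, j) < T (Suc i, j))"
  by (auto simp: ssyt_def skew_diagram_def)

text \<open>Read in the untransposed diagram, \<open>U\<close> is weak down columns and strict along
  rows, as \<open>row_le\<close> requires of the second alphabet.\<close>

lemma ssyt_conjugate_iff:
  assumes "is_partition mu" "is_partition la"
  shows "U \<in> ssyt (conjugate la) (conjugate mu) \<longleftrightarrow>
    U \<in> extensional (skew_diagram (conjugate la) (conjugate mu)) \<and>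
    (\<forall>i j. mu i \<le> j \<and> j < la i \<and> mu (Suc i) \<le> j \<and> j < la (Suc i) \<longrightarrow> U (j, i) \<le> U (j, Suc i)) \<and>
    (\<forall>i j. mu i \<le> j \<and> Suc j < la i \<longrightarrow> U (j, i) < U (Suc j, i))"
  unfolding ssyt_def skew_diagram_def
  by (auto simp: less_conjugate_iff conjugate_le_iff assms)

text \<open>The alphabet of a cell is determined by whether it lies in \<open>mu\<close>, so
  \<open>projl\<close> and \<open>projr\<close> recover the two fillings; restriction to the
  diagrams matches the extensionality in \<open>ssyt\<close>.\<close>

lemma bij_betw_glue:
  assumes la: "is_partition la" "partition_length la \<le> 2" and mu: "is_partition mu" "mu \<le> la"
  shows "bij_betw (\<lambda>TU. (glue la mu TU 0, glue la mu TU 1))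
    (ssyt mu (\<lambda>_. 0) \<times> ssyt (conjugate la) (conjugate mu))
    {p \<in> tableaux 0. outer_shape p = la \<and> inner_shape p = mu}" (is "bij_betw ?f ?S ?T")
proof -
  let ?D = "skew_diagram mu (\<lambda>_. 0)" and ?E = "skew_diagram (conjugate la) (conjugate mu)"
  let ?g = "\<lambda>p. (restrict (\<lambda>(i, j). projl (two_rows p i ! j)) ?D,
    restrict (\<lambda>(j, i). projr (two_rows p i ! j)) ?E)"
  note T_iff = tableaux_outer_shape_iff[OF la mu(2)]
  have le: "mu i \<le> la i" "mu (Suc i) \<le> mu i" "la (Suc i) \<le> la i" for i
    using la mu by (auto simp: le_fun_def is_partition_def antimono_def)
  have D: "(i, j) \<in> ?D \<longleftrightarrow> j < mu i" for i j
    by (simp add: skew_diagram_def)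
  have E: "(j, i) \<in> ?E \<longleftrightarrow> mu i \<le> j \<and> j < la i" for i j
    using la mu by (simp add: skew_diagram_def less_conjugate_iff conjugate_le_iff)
  have row_words: "two_rows (?f TU) i = glue la mu TU i" for TU i
    using two_row_partition[OF la, of i] by (auto simp: two_rows_def glue_def split: prod.split)
  have f: "?f (T, U) \<in> ?T \<and> ?g (?f (T, U)) = (T, U)" if TU: "(T, U) \<in> ?S" for T U
  proof
    have T: "T \<in> ssyt mu (\<lambda>_. 0)" and U: "U \<in> ssyt (conjugate la) (conjugate mu)"
      using TU by auto
    note T' = T[unfolded ssyt_straight_iff] and U' = U[unfolded ssyt_conjugate_iff[OF mu(1) la(1)]]
    have cell: "glue la mu (T, U) i ! j = (if j < mu i then Inl (T (i, j)) else Inr (U (j, i)))"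
      if "j < la i" for i j
      using that by (simp add: glue_def)
    have "row_le (glue la mu (T, U) i ! j) (glue la mu (T, U) i ! Suc j)" if "Suc j < la i" for i j
      using that T' U' by (auto simp: cell)
    moreover have "\<not> row_le (glue la mu (T, U) (Suc i) ! j) (glue la mu (T, U) i ! j)"
      if "j < la (Suc i)" for i j
    proof -
      have "j < la i" using that le(3) by (rule less_le_trans)
      \<comment> \<open>A first-alphabet letter above a second-alphabet one is always allowed; the
        reverse combination is excluded because \<open>mu\<close> is weakly decreasing.\<close>
      consider "j < mu (Suc i)" "j < mu i" | "mu (Suc i) \<le> j" "j < mu i" | "mu (Suc i) \<le> j" "mu i \<le> j"
        using le(2)[of i] by linarith
      then show ?thesis
        using that \<open>j < la i\<close> T' U' by cases (simp_all add: cell not_le not_less)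
    qed
    ultimately have "?f (T, U) \<in> tableaux 0 \<and> outer_shape (?f (T, U)) = la \<and> inner_shape (?f (T, U)) = mu"
      unfolding T_iff row_words by (auto simp: cell) (simp add: glue_def)
    then show "?f (T, U) \<in> ?T" by blast
    have "restrict (\<lambda>(i, j). projl (glue la mu (T, U) i ! j)) ?D = T"
    proof (rule extensionalityI[of _ ?D])
      fix c assume "c \<in> ?D"
      then show "restrict (\<lambda>(i, j). projl (glue la mu (T, U) i ! j)) ?D c = T c"
        using le(1)[of "fst c"] by (cases c) (auto simp: D cell dest: less_le_trans)
    qed (use T' in auto)
    moreover have "restrict (\<lambda>(j, i). projr (glue la mu (T, U) i ! j)) ?E = U"
    proof (rule extensionalityI[of _ ?E])
      fix c assume "c \<in> ?E"
      then show "restrict (\<lambda>(j, i). projr (glue la mu (T, U) i ! j)) ?E c = U c"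
        by (cases c) (auto simp: E cell)
    qed (use U' in auto)
    ultimately show "?g (?f (T, U)) = (T, U)"
      unfolding row_words by simp
  qed
  have g: "?g p \<in> ?S \<and> ?f (?g p) = p" if "p \<in> ?T" for p
  proof
    let ?F = "\<lambda>i j. two_rows p i ! j"
    have len: "\<And>i. length (two_rows p i) = la i"
      and isl: "\<And>i j. j < la i \<Longrightarrow> isl (?F i j) = (j < mu i)"
      and row: "\<And>i j. Suc j < la i \<Longrightarrow> row_le (?F i j) (?F i (Suc j))"
      and col: "\<And>i j. j < la (Suc i) \<Longrightarrow> \<not> row_le (?F (Suc i) j) (?F i j)"
      using that T_iff[of p] by blast+
    have l: "?F i j = Inl (projl (?F i j))" if "j < mu i" for i j
      using isl[of j i] that le(1)[of i] by simp
    have r: "?F i j = Inr (projr (?F i j))" if "mu i \<le> j" "j < la i" for i j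
      using isl[of j i] that by simp
    have "projl (?F i j) \<le> projl (?F i (Suc j))" if "Suc j < mu i" for i j
      using row[of j i] l[of j i] l[of "Suc j" i] that le(1)[of i]
      by (metis Suc_lessD less_le_trans row_le.simps(1))
    moreover have "projl (?F i j) < projl (?F (Suc i) j)" if "j < mu i" "j < mu (Suc i)" for i j
      using col[of j i] l[of j i] l[of j "Suc i"] that le(1)[of "Suc i"]
      by (metis less_le_trans not_le row_le.simps(1))
    moreover have "projr (?F i j) \<le> projr (?F (Suc i) j)"
      if "mu i \<le> j" "j < la i" "mu (Suc i) \<le> j" "j < la (Suc i)" for i j
      using col[of j i] r[of i j] r[of "Suc i" j] that
      by (metis not_le row_le.simps(4))
    moreover have "projr (?F i j) < projr (?F i (Suc j))" if "mu i \<le> j" "Suc j < la i" for i j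
      using row[of j i] r[of i j] r[of i "Suc j"] that
      by (metis Suc_lessD le_SucI row_le.simps(4))
    ultimately show "?g p \<in> ?S"
      unfolding mem_Times_iff fst_conv snd_conv ssyt_straight_iff ssyt_conjugate_iff[OF mu(1) la(1)]
      by (auto simp: D E)
    have "glue la mu (?g p) i = two_rows p i" for i
    proof (rule nth_equalityI)
      fix j assume "j < length (glue la mu (?g p) i)"
      then have "j < la i" by (simp add: glue_def)
      then show "glue la mu (?g p) i ! j = two_rows p i ! j"
        using l[of j i] r[of i j] by (auto simp: glue_def D E)
    qed (simp add: glue_def len)
    then show "?f (?g p) = p"
      by (simp add: two_rows_def)
  qed
  show ?thesis
  proof (rule bij_betw_byWitness)
    have f': "?f TU \<in> ?T \<and> ?g (?f TU) = TU" if "TU \<in> ?S" for TU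
      using f[of "fst TU" "snd TU"] that by (simp only: prod.collapse)
    show "\<forall>p\<in>?S. ?g (?f p) = p" "?f ` ?S \<subseteq> ?T"
      using f' by blast+
    show "\<forall>p\<in>?T. ?f (?g p) = p" "?g ` ?T \<subseteq> ?S"
      using g by blast+
  qed
qed

lemma pair_weight_glue:
  assumes la: "is_partition la" "partition_length la \<le> 2" and mu: "is_partition mu" "mu \<le> la"
  shows "pair_weight (glue la mu (T, U) 0, glue la mu (T, U) 1)
    = (\<Sum>c\<in>skew_diagram mu (\<lambda>_. 0). 2 * T c + 1)
      + (\<Sum>c\<in>skew_diagram (conjugate la) (conjugate mu). 2 * (U c + 1))"
proof -
  let ?l = "\<lambda>i j. letter_weight (if j < mu i then Inl (T (i, j)) else Inr (U (j, i)))"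
  have le: "mu i \<le> la i" for i
    using mu(2) by (simp add: le_fun_def)
  have bound: "i < 2" if "j < la i" for i j
    using two_row_partition[OF la, of i] that by (cases "i < 2") auto
  have "word_weight (glue la mu (T, U) i) = (\<Sum>j<la i. ?l i j)" for i
    by (simp add: word_weight_def glue_def interv_sum_list_conv_sum_set_nat atLeast0LessThan comp_def)
  also have "(\<Sum>j<la i. ?l i j) = (\<Sum>j<mu i. 2 * T (i, j) + 1) + (\<Sum>j\<in>{mu i..<la i}. 2 * (U (j, i) + 1))" for i
  proof -
    have "{..<la i} = {..<mu i} \<union> {mu i..<la i}"
      using le[of i] by auto
    then have "(\<Sum>j<la i. ?l i j) = (\<Sum>j\<in>{..<mu i} \<union> {mu i..<la i}. ?l i j)"
      by (simp only:)
    also have "\<dots> = (\<Sum>j<mu i. ?l i j) + (\<Sum>j\<in>{mu i..<la i}. ?l i j)"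
      by (rule sum.union_disjoint) auto
    finally show ?thesis by simp
  qed
  finally have word: "word_weight (glue la mu (T, U) i)
      = (\<Sum>j<mu i. 2 * T (i, j) + 1) + (\<Sum>j\<in>{mu i..<la i}. 2 * (U (j, i) + 1))" for i .
  have "skew_diagram mu (\<lambda>_. 0) = Sigma {..<2} (\<lambda>i. {..<mu i})"
    using bound le by (auto simp: skew_diagram_def dest: less_le_trans)
  then have D: "(\<Sum>c\<in>skew_diagram mu (\<lambda>_. 0). 2 * T c + 1) = (\<Sum>i<2. \<Sum>j<mu i. 2 * T (i, j) + 1)"
    by (simp add: sum.Sigma)
  have "skew_diagram la mu = Sigma {..<2} (\<lambda>i. {mu i..<la i})"
    using bound by (auto simp: skew_diagram_def)
  then have E: "(\<Sum>c\<in>skew_diagram (conjugate la) (conjugate mu). 2 * (U c + 1))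
      = (\<Sum>i<2. \<Sum>j\<in>{mu i..<la i}. 2 * (U (j, i) + 1))"
    unfolding skew_diagram_conjugate[OF mu(1) la(1)]
    by (simp add: sum.reindex sum.Sigma) (auto intro: sum.cong)
  show ?thesis
    unfolding D E by (simp add: pair_weight_def word numeral_2_eq_2)
qed

lemma finite_skew_diagram:
  assumes "is_partition la"
  shows "finite (skew_diagram la mu)"
proof (rule finite_subset)
  show "skew_diagram la mu \<subseteq> Sigma {i. la i \<noteq> 0} (\<lambda>i. {..<la i})"
    by (auto simp: skew_diagram_def)
  show "finite (Sigma {i. la i \<noteq> 0} (\<lambda>i. {..<la i}))"
    using assms by (auto simp: is_partition_def)
qed

text \<open>A second-alphabet letter cannot stand above a first-alphabet one, so the first-alphabet
  prefix of the second row is no longer than that of the first.\<close>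

lemma inner_shape_partition:
  assumes "p \<in> tableaux 0"
  shows "is_partition (inner_shape p)" "inner_shape p \<le> outer_shape p"
proof -
  obtain A B where p: "p = (A, B)" by fastforce
  have AB: "A \<in> row_words" "B \<in> row_words" "length B \<le> length A"
    and col: "\<And>j. j < length B \<Longrightarrow> \<not> row_le (B ! j) (A ! j)"
    using assms by (auto simp: p tableaux_def wide_pairs_def crosses_def)
  have "length (filter isl B) \<le> length (filter isl A)"
  proof (cases "length (filter isl B)")
    case (Suc j)
    then have j: "j < length B"
      using length_filter_le[of isl B] by simp
    then have "isl (B ! j)"
      using row_words_isl_nth[OF AB(2)] Suc by simp
    then have "isl (A ! j)"
      using col[OF j] by (cases "A ! j"; cases "B ! j") auto
    then show ?thesis
      using row_words_isl_nth[OF AB(1), of j] j AB(3) Suc by simp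
  qed simp
  then have "antimono (inner_shape p)"
    by (auto simp: antimono_def inner_shape_def two_rows_def p)
  moreover have "{i. inner_shape p i \<noteq> 0} \<subseteq> {0, 1}"
    by (auto simp: inner_shape_def two_rows_def split: if_splits)
  ultimately show "is_partition (inner_shape p)"
    unfolding is_partition_def using finite_subset by blast
  show "inner_shape p \<le> outer_shape p"
    by (auto simp: le_fun_def inner_shape_def outer_shape_def)
qed

text \<open>The summand for \<open>mu\<close> counts the tableaux with inner shape
  \<open>mu\<close>, so summing over \<open>mu\<close> collects the fibres of
  \<open>inner_shape\<close>.\<close>

lemma hook_schur_eq_weight_gf:
  assumes la: "is_partition la" "partition_length la \<le> 2"
  shows "hook_schur la q_r q_n
    = (weight_gf pair_weight {p \<in> tableaux 0. outer_shape p = la} :: 'a::field_char_0 fps)"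
proof -
  let ?M = "{mu. is_partition mu \<and> mu \<le> la}" and ?U = "{p \<in> tableaux 0. outer_shape p = la}"
  have "schur mu q_r * skew_schur (conjugate la) (conjugate mu) q_n
      = (weight_gf pair_weight {p \<in> ?U. inner_shape p = mu} :: 'a fps)" if "mu \<in> ?M" for mu
  proof -
    have mu: "is_partition mu" "mu \<le> la"
      using that by auto
    let ?D = "skew_diagram mu (\<lambda>_. 0)" and ?E = "skew_diagram (conjugate la) (conjugate mu)"
    have fin: "finite ?D" "finite ?E"
      using la mu by (simp_all add: finite_skew_diagram skew_diagram_conjugate)
    have "schur mu q_r = (weight_gf (\<lambda>T. \<Sum>c\<in>?D. 2 * T c + 1) (ssyt mu (\<lambda>_. 0)) :: 'a fps)"
      unfolding schur_def q_r_def[abs_def]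
      by (rule skew_schur_fps_X_power) (auto simp: fin le_fun_def)
    moreover have "skew_schur (conjugate la) (conjugate mu) q_n
        = (weight_gf (\<lambda>U. \<Sum>c\<in>?E. 2 * (U c + 1)) (ssyt (conjugate la) (conjugate mu)) :: 'a fps)"
      unfolding q_n_def[abs_def]
      by (rule skew_schur_fps_X_power) (use fin la mu in \<open>auto intro: conjugate_mono\<close>)
    ultimately have "schur mu q_r * skew_schur (conjugate la) (conjugate mu) q_n
        = (weight_gf (\<lambda>(T, U). (\<Sum>c\<in>?D. 2 * T c + 1) + (\<Sum>c\<in>?E. 2 * (U c + 1)))
            (ssyt mu (\<lambda>_. 0) \<times> ssyt (conjugate la) (conjugate mu)) :: 'a fps)"
      using finite_fibres_ssyt[OF fin(1), of "\<lambda>k. 2 * k + 1"]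
        finite_fibres_ssyt[OF fin(2), of "\<lambda>k. 2 * (k + 1)"]
      by (simp add: weight_gf_times)
    also have "\<dots> = weight_gf pair_weight {p \<in> tableaux 0. outer_shape p = la \<and> inner_shape p = mu}"
      by (rule weight_gf_bij_betw[OF bij_betw_glue[OF la mu], symmetric])
        (simp only: split_paired_all prod.case pair_weight_glue[OF la mu])
    also have "{p \<in> tableaux 0. outer_shape p = la \<and> inner_shape p = mu} = {p \<in> ?U. inner_shape p = mu}"
      by auto
    finally show ?thesis .
  qed
  then have "hook_schur la q_r q_n
      = (\<Sum>mu\<in>?M. weight_gf pair_weight {p \<in> ?U. inner_shape p = mu} :: 'a fps)"
    by (simp add: hook_schur_def)
  also have "\<dots> = weight_gf pair_weight ?U"
  proof (rule sum_weight_gf_fibres[OF finite_fibres_pair_weight])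
    show "inner_shape ` ?U \<subseteq> ?M"
      using inner_shape_partition by auto
    \<comment> \<open>A partition inside \<open>la\<close> is determined by its first two parts, so
      the index set is finite.\<close>
    have "?M \<subseteq> (\<lambda>(a, b) i. if i = 0 then a else if i = 1 then b else 0) ` ({..la 0} \<times> {..la 1})"
    proof
      fix mu assume "mu \<in> ?M"
      then have le: "mu i \<le> la i" for i by (simp add: le_fun_def)
      have "mu = (\<lambda>(a, b) i. if i = 0 then a else if i = 1 then b else 0) (mu 0, mu 1)"
      proof
        fix i
        show "mu i = (\<lambda>(a, b) i. if i = 0 then a else if i = 1 then b else 0) (mu 0, mu 1) i"
          using le[of i] two_row_partition[OF la, of i] by auto
      qed
      then show "mu \<in> (\<lambda>(a, b) i. if i = 0 then a else if i = 1 then b else 0) ` ({..la 0} \<times> {..la 1})"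
        using le by blast
    qed
    then show "finite ?M"
      by (rule finite_subset) simp
  qed
  finally show ?thesis .
qed

section \<open>Summation over the shapes\<close>

lemma outer_shape_tableaux:
  assumes "p \<in> tableaux d"
  shows "is_partition (outer_shape p)" "partition_length (outer_shape p) \<le> 2"
    "outer_shape p 1 + d \<le> outer_shape p 0"
proof -
  obtain A B where p: "p = (A, B)" by fastforce
  show gap: "outer_shape p 1 + d \<le> outer_shape p 0"
    using assms by (auto simp: p tableaux_def wide_pairs_def outer_shape_def two_rows_def)
  have supp: "{i. outer_shape p i \<noteq> 0} \<subseteq> {0, 1}"
    by (auto simp: outer_shape_def two_rows_def split: if_splits)
  have "antimono (outer_shape p)"
    using gap by (auto simp: antimono_def outer_shape_def two_rows_def)
  then show "is_partition (outer_shape p)"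
    unfolding is_partition_def using finite_subset[OF supp] by simp
  show "partition_length (outer_shape p) \<le> 2"
    unfolding partition_length_def using card_mono[OF _ supp] by simp
qed

lemma has_sum_hook_schur:
  "((\<lambda>mu. hook_schur mu q_r q_n) has_sum
      (fps_X ^ d * inverse (1 + fps_X ^ (2 * d + 1)) * q_product :: 'a::field_char_0 fps))
    {mu. is_partition mu \<and> partition_length mu \<le> 2 \<and> mu 1 + d \<le> mu 0}" (is "(_ has_sum ?P) ?I")
proof -
  have "weight_gf pair_weight {p \<in> tableaux d. outer_shape p = mu} = (hook_schur mu q_r q_n :: 'a fps)"
    if "mu \<in> ?I" for mu
  proof -
    \<comment> \<open>The gap condition defining the index set makes the fibres over
      \<open>mu\<close> in \<open>tableaux d\<close> and \<open>tableaux 0\<close> coincide.\<close>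
    have "{p \<in> tableaux d. outer_shape p = mu} = {p \<in> tableaux 0. outer_shape p = mu}"
      using that by (auto simp: tableaux_def wide_pairs_def outer_shape_def two_rows_def)
    then show ?thesis
      using that by (simp add: hook_schur_eq_weight_gf)
  qed
  moreover have "((\<lambda>mu. weight_gf pair_weight {p \<in> tableaux d. outer_shape p = mu}) has_sum
      (weight_gf pair_weight (tableaux d) :: 'a fps)) ?I"
    by (rule has_sum_weight_gf_fibres[OF finite_fibres_pair_weight])
      (use outer_shape_tableaux in blast)
  ultimately have "((\<lambda>mu. hook_schur mu q_r q_n) has_sum
      (weight_gf pair_weight (tableaux d) :: 'a fps)) ?I"
    using has_sum_cong by (metis (no_types, lifting))
  moreover have "weight_gf pair_weight (tableaux d) = ?P"
  proof -
    let ?u = "1 + fps_X ^ (2 * d + 1) :: 'a fps"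
    \<comment> \<open>\<open>corr_closed\<close> and \<open>corr_0_1\<close> give the sum times
      \<open>?u\<close>, a factor with constant term 1 that can be inverted.\<close>
    have eq: "?u * weight_gf pair_weight (tableaux d) = fps_X ^ d * q_product"
      unfolding weight_gf_tableaux corr_def[symmetric] corr_closed mult.assoc[of "fps_X ^ d"] corr_0_1 ..
    have "inverse ?u * ?u = 1"
      by (rule inverse_mult_eq_1) simp
    then have "weight_gf pair_weight (tableaux d) = inverse ?u * (?u * weight_gf pair_weight (tableaux d))"
      by (simp only: mult.assoc[symmetric] mult_1_left)
    also have "\<dots> = ?P"
      unfolding eq by (simp only: mult_ac)
    finally show ?thesis .
  qed
  ultimately show ?thesis by simp
qed

theorem theorem4p2:
  fixes lam :: int
  shows "(lam \<ge> 0 \<longrightarrow>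
      ((\<lambda>mu. hook_schur mu q_r q_n) has_sum
        (fps_X ^ nat lam * inverse (1 + fps_X ^ nat (2 * lam + 1)) * q_product
          :: 'a::field_char_0 fps))
        {mu. is_partition mu \<and> partition_length mu \<le> 2 \<and> int (mu 0) - int (mu 1) \<ge> lam})
    \<and> (lam < 0 \<longrightarrow>
      ((\<lambda>mu. hook_schur mu q_r q_n) has_sum
        (fps_X ^ nat (- (lam + 1)) * inverse (1 + fps_X ^ nat (- 2 * lam - 1)) * q_product
          :: 'a fps))
        {mu. is_partition mu \<and> partition_length mu \<le> 2 \<and> int (mu 1) - int (mu 0) - 1 \<le> lam})"
proof (intro conjI impI)
  assume "lam \<ge> 0"
  then obtain d where d: "lam = int d"
    using nonneg_int_cases by blast
  have "nat (2 * lam + 1) = 2 * d + 1" "\<And>a b. int a - int b \<ge> lam \<longleftrightarrow> b + d \<le> a"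
    using d by auto
  then show "((\<lambda>mu. hook_schur mu q_r q_n) has_sum
      (fps_X ^ nat lam * inverse (1 + fps_X ^ nat (2 * lam + 1)) * q_product :: 'a fps))
      {mu. is_partition mu \<and> partition_length mu \<le> 2 \<and> int (mu 0) - int (mu 1) \<ge> lam}"
    using has_sum_hook_schur[of d] by (simp add: d)
next
  assume "lam < 0"
  \<comment> \<open>With \<open>d = - lam - 1\<close> the negative case becomes the same identity:
    \<open>2 * d + 1 = - 2 * lam - 1\<close>, and the condition on \<open>mu\<close> again says that
    the gap is at least \<open>d\<close>.\<close>
  then obtain d where d: "- (lam + 1) = int d"
    using nonneg_int_cases[of "- (lam + 1)"] by auto
  have "nat (- (lam + 1)) = d" "nat (- 2 * lam - 1) = 2 * d + 1"
    "\<And>a b. int b - int a - 1 \<le> lam \<longleftrightarrow> b + d \<le> a"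
    using d by auto
  then show "((\<lambda>mu. hook_schur mu q_r q_n) has_sum
      (fps_X ^ nat (- (lam + 1)) * inverse (1 + fps_X ^ nat (- 2 * lam - 1)) * q_product :: 'a fps))
      {mu. is_partition mu \<and> partition_length mu \<le> 2 \<and> int (mu 1) - int (mu 0) - 1 \<le> lam}"
    using has_sum_hook_schur[of d] by (simp only:)
qed

end
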